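(* Let $X=(X_1,\dots,X_n)$ be a random vector in $\mathbb{R}_+^n$ (with arbitrary distribution), let $\Phi\in\mathbb{R}_+^{m\times n}$ and $\lambda=(\lambda_1,\dots,\lambda_m)\in\mathbb{R}_+^m$, and let $Y=(Y_1,\dots,Y_m)\in\mathbb{Z}_+^m$ be the output of the vector Poisson channel with input $X$, scaling matrix $\Phi$ and dark current $\lambda$, i.e. $$P(Y|X)=\prod_{i=1}^m P(Y_i|X)=\prod_{i=1}^m \mathrm{Pois}\big((\Phi X)_i+\lambda_i\big).$$ Assume that the regularity conditions permitting free interchange of the differential operators $\partial/\partial\Phi_{ij}$, $\partial/\partial\lambda_i$ with the expectation operator hold. Then, irrespective of the input distribution, for all $1\le i\le m$ and $1\le j\le n$, the gradient of the mutual information $I(X;Y)$ with respect to the scaling matrix is given by $$\nabla_\Phi I(X;Y)_{ij}=\mathbb{E}\big[X_j\log((\Phi X)_i+\lambda_i)\big]-\mathbb{E}\Big[\mathbb{E}[X_j|Y]\,\log\mathbb{E}\big[(\Phi X)_i+\lambda_i\,\big|\,Y\big]\Big],$$ and the gradient with respect to the dark current is given by $$\nabla_\lambda I(X;Y)_i=\mathbb{E}\big[\log((\Phi X)_i+\lambda_i)\big]-\mathbb{E}\Big[\log\mathbb{E}\big[(\Phi X)_i+\lambda_i\,\big|\,Y\big]\Big].$$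
   Context: $\mathrm{Pois}(z)$ denotes the Poisson distribution with parameter $z$; given $X$, the components $Y_1,\dots,Y_m$ are conditionally independent. $(\Phi X)_i$ is the $i$-th entry of the vector $\Phi X$. All logarithms are natural. $I(X;Y)$ is the mutual information between $X$ and $Y$, regarded as a function of $\Phi$ and $\lambda$ for a fixed distribution of $X$. $\nabla_\Phi I(X;Y)$ is the $m\times n$ matrix whose $(i,j)$ entry is $\nabla_\Phi I(X;Y)_{ij}=\partial I(X;Y)/\partial\Phi_{ij}$, and $\nabla_\lambda I(X;Y)$ is the vector whose $i$-th entry is $\nabla_\lambda I(X;Y)_i=\partial I(X;Y)/\partial\lambda_i$. Standing assumption: the regularity conditions needed to interchange freely the order of integration and differentiation (i.e. of $\partial/\partial\Phi_{ij}$, $\partial/\partial\lambda_i$ and $\mathbb{E}(\cdot)$) hold. *)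

theory Defs
  imports "HOL-Probability.Probability"
begin

text \<open>
  The library's \<open>poisson_pmf\<close> is only specified for positive rates, whereas a Poisson channel
  without dark current may have rate zero: \<open>Pois(0)\<close> is the point mass at \<open>0\<close>.
\<close>

definition pois :: "real \<Rightarrow> nat pmf" where
  "pois z = (if 0 < z then poisson_pmf z else return_pmf 0)"

lemma pmf_pois: "0 \<le> z \<Longrightarrow> pmf (pois z) k = z ^ k / fact k * exp (- z)"
  by (cases "z = 0") (auto simp: pois_def power_0_left indicator_def)

definition channel_rate :: "real^'n^'m \<Rightarrow> real^'m \<Rightarrow> real^'n \<Rightarrow> 'm \<Rightarrow> real" where
  "channel_rate \<Phi> lam x i = (\<Phi> *v x) $ i + lam $ i"

definition channel_prob :: "real^'n^'m \<Rightarrow> real^'m \<Rightarrow> real^'n \<Rightarrow> nat^'m \<Rightarrow> real" where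
  "channel_prob \<Phi> lam x y = (\<Prod>i\<in>UNIV. pmf (pois (channel_rate \<Phi> lam x i)) (y $ i))"

definition output_prob ::
    "(real^'n) measure \<Rightarrow> real^'n^'m \<Rightarrow> real^'m \<Rightarrow> nat^'m \<Rightarrow> real" where
  "output_prob D \<Phi> lam y = (\<integral>x. channel_prob \<Phi> lam x y \<partial>D)"

text \<open>
  The law of \<open>(X, Y)\<close> when \<open>X\<close> has distribution \<open>D\<close>.  On this space the input is \<open>fst\<close> and the
  output is \<open>snd\<close>.
\<close>

definition channel ::
    "(real^'n) measure \<Rightarrow> real^'n^'m \<Rightarrow> real^'m \<Rightarrow> ((real^'n) \<times> (nat^'m)) measure" where
  "channel D \<Phi> lam =
     density (D \<Otimes>\<^sub>M count_space UNIV) (\<lambda>(x, y). ennreal (channel_prob \<Phi> lam x y))"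

text \<open>The base \<open>exp 1\<close> makes the mutual information a quantity in nats.\<close>

definition mutual_info :: "(real^'n) measure \<Rightarrow> real^'n^'m \<Rightarrow> real^'m \<Rightarrow> real" where
  "mutual_info D \<Phi> lam =
     prob_space.mutual_information (channel D \<Phi> lam) (exp 1) borel (count_space UNIV) fst snd"

definition cond_exp_output ::
    "((real^'n) \<times> (nat^'m)) measure \<Rightarrow> ((real^'n) \<times> (nat^'m) \<Rightarrow> real) \<Rightarrow>
      (real^'n) \<times> (nat^'m) \<Rightarrow> real" where
  "cond_exp_output J f =
     real_cond_exp J (vimage_algebra (space J) snd (count_space UNIV)) f"

definition upd_vec :: "real^'m \<Rightarrow> 'm \<Rightarrow> real \<Rightarrow> real^'m" where
  "upd_vec v i t = (\<chi> k. if k = i then t else v $ k)"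

definition upd_mat :: "real^'n^'m \<Rightarrow> 'm \<Rightarrow> 'n \<Rightarrow> real \<Rightarrow> real^'n^'m" where
  "upd_mat A i j t = (\<chi> k l. if k = i \<and> l = j then t else A $ k $ l)"

text \<open>
  Differentiation at \<open>t\<close> and integration over \<open>M\<close> may be interchanged for the family \<open>f\<close>.  All
  parameters of the channel are nonnegative, so the derivative is taken within \<open>{0..}\<close>: it is
  two-sided for \<open>t > 0\<close> and the right derivative for \<open>t = 0\<close>.
\<close>

definition interchangeable :: "'a measure \<Rightarrow> (real \<Rightarrow> 'a \<Rightarrow> real) \<Rightarrow> real \<Rightarrow> bool" where
  "interchangeable M f t \<longleftrightarrow>
     (\<exists>e>0. \<forall>s\<ge>0. \<bar>s - t\<bar> < e \<longrightarrow> integrable M (f s)) \<and>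
     (\<exists>f'. (AE z in M. ((\<lambda>s. f s z) has_real_derivative f' z) (at t within {0..})) \<and>
           integrable M f' \<and>
           ((\<lambda>s. \<integral>z. f s z \<partial>M) has_real_derivative (\<integral>z. f' z \<partial>M)) (at t within {0..}))"

text \<open>
  The regularity conditions along a one-parameter family of channels \<open>(\<Phi> s, lam s)\<close>: the
  derivative in the parameter may be exchanged with the expectations giving the output
  distribution \<open>P(y) = E[P(y|X)]\<close>, the total mass of the law of \<open>(X, Y)\<close>, and
  \<open>I(X;Y) = E[ln (P(Y|X) / P(Y))]\<close>.  As the law of \<open>(X, Y)\<close> itself depends on the parameter, the
  last two are written as integrals over the fixed measure \<open>D \<Otimes>\<^sub>M count_space UNIV\<close>.
\<close>

definition regular_at ::
    "(real^'n) measure \<Rightarrow> (real \<Rightarrow> real^'n^'m) \<Rightarrow> (real \<Rightarrow> real^'m) \<Rightarrow> real \<Rightarrow> bool" where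
  "regular_at D \<Phi> lam t \<longleftrightarrow>
     (\<forall>y. interchangeable D (\<lambda>s x. channel_prob (\<Phi> s) (lam s) x y) t) \<and>
     interchangeable (D \<Otimes>\<^sub>M count_space UNIV)
       (\<lambda>s (x, y). channel_prob (\<Phi> s) (lam s) x y) t \<and>
     interchangeable (D \<Otimes>\<^sub>M count_space UNIV)
       (\<lambda>s (x, y). channel_prob (\<Phi> s) (lam s) x y *
          ln (channel_prob (\<Phi> s) (lam s) x y / output_prob D (\<Phi> s) (lam s) y)) t"

text \<open>
  The expectation of \<open>a log r\<close> exists and is finite, where \<open>log 0 = -\<infinity>\<close> and \<open>0 log 0 = 0\<close>.  The
  first conjunct is needed because \<open>ln 0 = 0\<close> in the library.
\<close>

definition log_expectation_finite :: "'a measure \<Rightarrow> ('a \<Rightarrow> real) \<Rightarrow> ('a \<Rightarrow> real) \<Rightarrow> bool" where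
  "log_expectation_finite M a r \<longleftrightarrow>
     (AE z in M. r z = 0 \<longrightarrow> a z = 0) \<and> integrable M (\<lambda>z. a z * ln (r z))"

end

theory Submission
  imports Defs
begin

text \<open>
  Along a path moving the rate \<open>r\<close> of the \<open>i\<close>-th output with speed \<open>a\<close> (which is \<open>X\<^sub>j\<close> or \<open>1\<close>), the
  channel law \<open>p(x, y)\<close> has derivative \<open>p a (y\<^sub>i / r - 1)\<close>.  Differentiating \<open>\<integral> p ln (p / q)\<close> leaves
  \<open>\<integral> p a (y\<^sub>i / r - 1) ln (p / q)\<close>, since the terms \<open>\<integral> p'\<close> and \<open>\<integral> p q' / q\<close> vanish by conservation of
  mass.  As \<open>p(x, y + e\<^sub>i) (y\<^sub>i + 1) = r p(x, y)\<close>, a summation by parts in \<open>y\<^sub>i\<close> moves the difference onto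
  \<open>ln (p / q)\<close>, and \<open>ln (p / q)\<close> changes by \<open>ln r - ln E[r | y]\<close> when \<open>y\<close> is replaced by \<open>y + e\<^sub>i\<close>.

  The delicate point is that \<open>p a ln (p / q)\<close> is not known to be integrable, so the boundary terms
  of the summation by parts do not vanish for free; integrability of the two sides alone
  suffices, through a linear cutoff in \<open>y\<^sub>i\<close>.
\<close>

section \<open>Summation by parts under a Poisson shift\<close>

text \<open>Abstract form of the summation by parts: \<open>T\<close> stands for y -> y + e_i with x
  fixed, \<open>\<kappa>\<close> for the count y_i, \<open>u\<close> for \<open>p a\<close>. By
  \<open>distr_T\<close>, \<open>T\<close> carries \<open>N\<close> onto its part with
  \<open>0 < \<kappa>\<close>, and \<open>u_T\<close> is the Poisson recursion. The product
  \<open>u L\<close> is first cut off at large \<open>\<kappa>\<close>, and the cutoff is then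
  removed by dominated convergence.\<close>

lemma shift_by_parts:
  fixes N :: "'a measure" and T :: "'a \<Rightarrow> 'a" and \<kappa> :: "'a \<Rightarrow> nat" and u r L :: "'a \<Rightarrow> real"
  assumes [measurable]: "T \<in> N \<rightarrow>\<^sub>M N" "\<kappa> \<in> N \<rightarrow>\<^sub>M count_space UNIV"
      "u \<in> borel_measurable N" "r \<in> borel_measurable N" "L \<in> borel_measurable N"
    and distr_T: "distr N N T = density N (\<lambda>z. ennreal (of_bool (0 < \<kappa> z)))"
    and \<kappa>_T: "\<And>z. \<kappa> (T z) = Suc (\<kappa> z)" and r_T: "\<And>z. r (T z) = r z"
    and r_nonneg: "AE z in N. 0 \<le> r z" and u_0: "AE z in N. r z = 0 \<longrightarrow> u z = 0"
    and u_T: "AE z in N. u (T z) * (real (\<kappa> z) + 1) = r z * u z"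
    and int_h: "integrable N (\<lambda>z. u z * (real (\<kappa> z) / r z - 1) * L z)"
    and int_g: "integrable N (\<lambda>z. u z * (L (T z) - L z))"
  shows "(\<integral>z. u z * (real (\<kappa> z) / r z - 1) * L z \<partial>N) = (\<integral>z. u z * (L (T z) - L z) \<partial>N)"
proof -
  define h where "h = (\<lambda>z. u z * (real (\<kappa> z) / r z - 1) * L z)"
  define g where "g = (\<lambda>z. u z * (L (T z) - L z))"
  define v where "v = (\<lambda>z. u z * L z)"
  define w where "w = (\<lambda>z. v z / (real (\<kappa> z) + 1))"
  have [measurable]: "h \<in> borel_measurable N" "g \<in> borel_measurable N" 
      "v \<in> borel_measurable N" "w \<in> borel_measurable N"
    unfolding h_def g_def v_def w_def by measurable
  have ih: "integrable N h" and ig: "integrable N g"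
    using int_h int_g by (auto simp: h_def g_def)
  \<comment> \<open>Change of variables along \<open>T\<close>: the weight
    \<open>of_bool (0 < \<kappa> z)\<close> disappears because \<open>F\<close> is zero where
    \<open>\<kappa>\<close> is.\<close>
  have shift: "(\<integral>z. F z \<partial>N) = (\<integral>z. F (T z) \<partial>N)"
    if [measurable]: "F \<in> borel_measurable N" and "\<And>z. \<kappa> z = 0 \<Longrightarrow> F z = 0" for F :: "'a \<Rightarrow> real"
  proof -
    have "(\<integral>z. F (T z) \<partial>N) = (\<integral>z. F z \<partial>distr N N T)"
      by (subst integral_distr) auto
    also have "\<dots> = (\<integral>z. of_bool (0 < \<kappa> z) *\<^sub>R F z \<partial>N)"
      unfolding distr_T by (subst integral_density) auto
    also have "\<dots> = (\<integral>z. F z \<partial>N)"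
      using that(2) by (intro Bochner_Integration.integral_cong) (auto simp: of_bool_def)
    finally show ?thesis ..
  qed
  have ihT: "integrable N (\<lambda>z. h (T z))"
  proof -
    have "integrable N (\<lambda>z. of_bool (0 < \<kappa> z) *\<^sub>R h z)"
      by (rule Bochner_Integration.integrable_bound[OF ih]) (auto simp: of_bool_def)
    then have "integrable (distr N N T) h"
      unfolding distr_T by (subst integrable_density) auto
    then show ?thesis
      by (simp add: integrable_distr_eq)
  qed
  \<comment> \<open>\<open>v\<close> itself need not be integrable.  Its part with \<open>\<bar>\<kappa> - r\<bar> \<ge> 1/2\<close> is controlled by \<open>h\<close> at the cost
    of the factor \<open>\<kappa> + 1\<close>; elsewhere \<open>\<kappa> + 1\<close> is far from \<open>r\<close>, so \<open>h \<circ> T\<close> controls \<open>u * (L \<circ> T)\<close>, from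
    which \<open>v\<close> differs by \<open>g\<close>.\<close>
  have w_le: "AE z in N. \<bar>w z\<bar> \<le> \<bar>g z\<bar> + 4 * \<bar>h z\<bar> + 2 * \<bar>h (T z)\<bar>"
    using r_nonneg u_0 u_T
  proof eventually_elim
    case (elim z)
    define k where "k = real (\<kappa> z)"
    have k: "0 \<le> k" by (simp add: k_def)
    show ?case
    proof (cases "r z = 0")
      case True
      with elim show ?thesis by (simp add: w_def v_def)
    next
      case False
      with elim have r: "0 < r z" by simp
      show ?thesis
      proof (cases "\<bar>k - r z\<bar> < 1/2")
        case False
        \<comment> \<open>If r \<le> 2(k + 1), then \<bar>k - r\<bar> \<ge> 1/2 gives a ratio of at
          least 1/(2r) \<ge> 1/(4(k + 1)). If r > 2(k + 1), then r - k exceeds r/2 and the ratio is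
          at least 1/2.\<close>
        have "1 / (4 * (k + 1)) \<le> \<bar>k - r z\<bar> / r z"
        proof (cases "r z \<le> 2 * (k + 1)")
          case True
          have "r z * 1 \<le> (4 * (k + 1)) * \<bar>k - r z\<bar>"
          proof -
            have "(4 * (k + 1)) * (1/2) \<le> (4 * (k + 1)) * \<bar>k - r z\<bar>"
              using False k by (intro mult_left_mono) auto
            with True show ?thesis by (simp add: field_simps)
          qed
          then show ?thesis using r k by (simp add: field_simps)
        next
          case False
          have "1 / (4 * (k + 1)) \<le> 1 / 2" using k by (simp add: field_simps)
          also have "1 / 2 \<le> \<bar>k - r z\<bar> / r z"
            using False r k by (simp add: field_simps)
          finally show ?thesis .
        qed
        then have "\<bar>v z\<bar> * (1 / (4 * (k + 1))) \<le> \<bar>v z\<bar> * (\<bar>k - r z\<bar> / r z)"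
          by (intro mult_left_mono) auto
        also have "\<dots> = \<bar>h z\<bar>"
        proof -
          have "k / r z - 1 = (k - r z) / r z" using r by (simp add: field_simps)
          then have "h z = v z * ((k - r z) / r z)"
            unfolding h_def v_def k_def[symmetric] by simp
          then show ?thesis using r by (simp add: abs_mult abs_divide)
        qed
        finally have "\<bar>w z\<bar> \<le> 4 * \<bar>h z\<bar>"
          using k by (simp add: w_def k_def[symmetric] abs_divide field_simps)
        then show ?thesis by simp
      next
        case True
        have "h (T z) = u (T z) * ((k + 1) / r z - 1) * L (T z)"
          by (simp add: h_def \<kappa>_T r_T k_def add.commute)
        also have "u (T z) = r z * u z / (k + 1)"
          using elim k by (simp add: k_def field_simps)
        also have "r z * u z / (k + 1) * ((k + 1) / r z - 1) * L (T z)
            = u z * L (T z) * ((k + 1 - r z) / (k + 1))"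
        proof -
          have "(k + 1) / r z - 1 = (k + 1 - r z) / r z" using r by (simp add: field_simps)
          then show ?thesis using r k by simp
        qed
        finally have hT': "h (T z) = u z * L (T z) * ((k + 1 - r z) / (k + 1))" .
        have half: "1/2 \<le> k + 1 - r z" using True by linarith
        have hT: "\<bar>h (T z)\<bar> = \<bar>u z * L (T z)\<bar> * ((k + 1 - r z) / (k + 1))"
          using k half unfolding hT' by (simp add: abs_mult abs_divide)
        have "\<bar>u z * L (T z)\<bar> * ((1/2) / (k + 1)) \<le> \<bar>h (T z)\<bar>"
          unfolding hT using half k by (intro mult_left_mono divide_right_mono) auto
        then have 1: "\<bar>u z * L (T z)\<bar> / (k + 1) \<le> 2 * \<bar>h (T z)\<bar>"
          using k by (simp add: field_simps)
        have "\<bar>v z\<bar> \<le> \<bar>g z\<bar> + \<bar>u z * L (T z)\<bar>"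
          by (simp add: v_def g_def algebra_simps)
        then have "\<bar>w z\<bar> \<le> \<bar>g z\<bar> / (k + 1) + \<bar>u z * L (T z)\<bar> / (k + 1)"
          using k by (simp add: w_def k_def[symmetric] abs_divide add_divide_distrib[symmetric] divide_right_mono)
        moreover have "\<bar>g z\<bar> / (k + 1) \<le> \<bar>g z\<bar>"
          using k by (simp add: divide_le_eq mult_le_cancel_left1)
        ultimately show ?thesis using 1 by linarith
      qed
    qed
  qed
  have iw: "integrable N w"
  proof (rule Bochner_Integration.integrable_bound)
    show "integrable N (\<lambda>z. \<bar>g z\<bar> + 4 * \<bar>h z\<bar> + 2 * \<bar>h (T z)\<bar>)"
      using ig ih ihT by auto
    show "AE z in N. norm (w z) \<le> norm (\<bar>g z\<bar> + 4 * \<bar>h z\<bar> + 2 * \<bar>h (T z)\<bar>)"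
      using w_le by eventually_elim simp
  qed measurable
  \<comment> \<open>A cutoff whose increments are at most \<open>1 / (\<kappa> + 1)\<close>, so that the boundary terms of the
    summation by parts are dominated by \<open>\<bar>w\<bar>\<close>.\<close>
  define \<phi> where "\<phi> = (\<lambda>n k :: nat. max 0 (1 - real k / (real n + 1)))"
  have \<phi>_bounds: "0 \<le> \<phi> n k" "\<phi> n k \<le> 1" for n k by (auto simp: \<phi>_def)
  have \<phi>_abs: "\<phi> n k * \<bar>c\<bar> \<le> \<bar>c\<bar>" for n k c
    by (rule mult_left_le_one_le) (auto intro: \<phi>_bounds)
  have \<phi>_lim: "(\<lambda>n. \<phi> n k) \<longlonglongrightarrow> 1" for k
  proof -
    have "(\<lambda>n. real k / (1 + real n)) \<longlonglongrightarrow> 0"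
      by (intro tendsto_divide_0[OF tendsto_const] filterlim_at_top_imp_at_infinity
          filterlim_tendsto_add_at_top[OF tendsto_const] filterlim_real_sequentially)
    then have "(\<lambda>n. max 0 (1 - real k / (1 + real n))) \<longlonglongrightarrow> max 0 (1 - 0)"
      by (intro tendsto_intros)
    then show ?thesis by (simp add: \<phi>_def add.commute)
  qed
  have \<phi>_diff: "\<bar>\<phi> n (Suc k) - \<phi> n k\<bar> \<le> 1 / (real k + 1)" for n k
  proof (cases "k \<le> n")
    case True
    then have "\<phi> n k = 1 - real k / (real n + 1)" "\<phi> n (Suc k) = 1 - (real k + 1) / (real n + 1)"
      by (auto simp: \<phi>_def field_simps)
    then have "\<phi> n (Suc k) - \<phi> n k = - (1 / (real n + 1))"
      by (simp add: add_divide_distrib)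
    then have "\<bar>\<phi> n (Suc k) - \<phi> n k\<bar> = 1 / (real n + 1)"
      by simp
    with True show ?thesis by (simp add: frac_le)
  next
    case False
    then have "\<phi> n k = 0" "\<phi> n (Suc k) = 0" by (auto simp: \<phi>_def field_simps)
    then show ?thesis by simp
  qed
  \<comment> \<open>The cutoff vanishes for \<open>\<kappa> z > n\<close>, so
    \<open>\<phi> v\<close> is dominated by (n + 1)\<bar>w\<bar>. Finiteness of this integral is
    what allows it to be added and cancelled in \<open>parts\<close>.\<close>
  have iv: "integrable N (\<lambda>z. \<phi> n (\<kappa> z) * v z)" for n
  proof (rule Bochner_Integration.integrable_bound)
    show "integrable N (\<lambda>z. (real n + 1) * w z)" using iw by simp
    show "AE z in N. norm (\<phi> n (\<kappa> z) * v z) \<le> norm ((real n + 1) * w z)"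
    proof (rule AE_I2)
      fix z
      have *: "\<phi> n (\<kappa> z) \<le> (real n + 1) / (real (\<kappa> z) + 1)"
      proof (cases "\<kappa> z \<le> n")
        case True
        then have "1 \<le> (real n + 1) / (real (\<kappa> z) + 1)" by simp
        with \<phi>_bounds(2) show ?thesis by (rule order_trans)
      next
        case False
        then have "\<phi> n (\<kappa> z) = 0" by (auto simp: \<phi>_def field_simps)
        then show ?thesis by simp
      qed
      have "norm (\<phi> n (\<kappa> z) * v z) = \<phi> n (\<kappa> z) * \<bar>v z\<bar>"
        using \<phi>_bounds by (simp add: abs_mult)
      also have "\<dots> \<le> (real n + 1) / (real (\<kappa> z) + 1) * \<bar>v z\<bar>"
        by (rule mult_right_mono[OF *]) simp
      also have "\<dots> = norm ((real n + 1) * w z)"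
        by (simp add: w_def abs_mult abs_divide)
      finally show "norm (\<phi> n (\<kappa> z) * v z) \<le> norm ((real n + 1) * w z)" .
    qed
  qed measurable
  have i\<phi>h: "integrable N (\<lambda>z. \<phi> n (\<kappa> z) * h z)" for n
    by (rule Bochner_Integration.integrable_bound[OF ih])
       (auto simp: abs_mult \<phi>_abs \<phi>_bounds)
  have i\<phi>g: "integrable N (\<lambda>z. \<phi> n (Suc (\<kappa> z)) * g z)" for n
    by (rule Bochner_Integration.integrable_bound[OF ig])
       (auto simp: abs_mult \<phi>_abs \<phi>_bounds)
  have \<delta>_le: "\<bar>(\<phi> n (Suc (\<kappa> z)) - \<phi> n (\<kappa> z)) * v z\<bar> \<le> \<bar>w z\<bar>" for n z
    using mult_right_mono[OF \<phi>_diff[of n "\<kappa> z"] abs_ge_zero[of "v z"]]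
    by (simp add: w_def abs_mult abs_divide)
  have i\<delta>: "integrable N (\<lambda>z. (\<phi> n (Suc (\<kappa> z)) - \<phi> n (\<kappa> z)) * v z)" for n
    by (rule Bochner_Integration.integrable_bound[OF iw]) (use \<delta>_le in auto)
  \<comment> \<open>Adding \<open>\<phi> v\<close> to \<open>\<phi> h\<close> turns
    \<open>\<kappa> / r - 1\<close> into \<open>\<kappa> / r\<close>. The factor
    \<open>\<kappa>\<close> kills the boundary \<open>\<kappa> = 0\<close>, so \<open>shift\<close>
    applies, and the Poisson recursion then cancels \<open>\<kappa> / r\<close>. What remains is
    \<open>g\<close> and an increment of the cutoff.\<close>
  have parts: "(\<integral>z. \<phi> n (\<kappa> z) * h z \<partial>N) =
      (\<integral>z. \<phi> n (Suc (\<kappa> z)) * g z \<partial>N) + (\<integral>z. (\<phi> n (Suc (\<kappa> z)) - \<phi> n (\<kappa> z)) * v z \<partial>N)" for n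
  proof -
    have "(\<integral>z. \<phi> n (\<kappa> z) * h z \<partial>N) + (\<integral>z. \<phi> n (\<kappa> z) * v z \<partial>N)
        = (\<integral>z. \<phi> n (\<kappa> z) * (real (\<kappa> z) / r z) * v z \<partial>N)"
      by (subst Bochner_Integration.integral_add[symmetric, OF i\<phi>h iv])
         (auto simp: h_def v_def algebra_simps intro!: Bochner_Integration.integral_cong)
    also have "\<dots> = (\<integral>z. \<phi> n (\<kappa> (T z)) * (real (\<kappa> (T z)) / r (T z)) * v (T z) \<partial>N)"
      by (rule shift) auto
    also have "\<dots> = (\<integral>z. \<phi> n (Suc (\<kappa> z)) * g z + ((\<phi> n (Suc (\<kappa> z)) - \<phi> n (\<kappa> z)) * v z + \<phi> n (\<kappa> z) * v z) \<partial>N)"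
    proof (rule integral_cong_AE)
      show "AE z in N. \<phi> n (\<kappa> (T z)) * (real (\<kappa> (T z)) / r (T z)) * v (T z) =
          \<phi> n (Suc (\<kappa> z)) * g z + ((\<phi> n (Suc (\<kappa> z)) - \<phi> n (\<kappa> z)) * v z + \<phi> n (\<kappa> z) * v z)"
        using u_0 u_T
      proof eventually_elim
        case (elim z)
        \<comment> \<open>For \<open>r z = 0\<close> the left side is 0 by the convention on
          division by zero, and the right side is 0 by \<open>u_0\<close>.\<close>
        have "(real (\<kappa> z) + 1) / r z * u (T z) = u z"
          using elim by (cases "r z = 0") (auto simp: field_simps)
        then have "(1 + real (\<kappa> z)) / r z * (u (T z) * L (T z)) = u z * L (T z)"
          by (simp add: add.commute mult.assoc[symmetric])
        then have "(real (\<kappa> (T z)) / r (T z)) * v (T z) = u z * L (T z)"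
          by (simp add: \<kappa>_T r_T v_def)
        then have "\<phi> n (\<kappa> (T z)) * (real (\<kappa> (T z)) / r (T z)) * v (T z) = \<phi> n (Suc (\<kappa> z)) * (u z * L (T z))"
          by (simp only: mult.assoc \<kappa>_T)
        then show ?case by (simp add: g_def v_def algebra_simps)
      qed
    qed measurable
    also have "\<dots> = (\<integral>z. \<phi> n (Suc (\<kappa> z)) * g z \<partial>N) +
        ((\<integral>z. (\<phi> n (Suc (\<kappa> z)) - \<phi> n (\<kappa> z)) * v z \<partial>N) + (\<integral>z. \<phi> n (\<kappa> z) * v z \<partial>N))"
      using i\<phi>g i\<delta> iv by simp
    finally show ?thesis by simp
  qed
  have lim_h: "(\<lambda>n. \<integral>z. \<phi> n (\<kappa> z) * h z \<partial>N) \<longlonglongrightarrow> (\<integral>z. h z \<partial>N)"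
  proof (rule integral_dominated_convergence[where w = "\<lambda>z. \<bar>h z\<bar>"])
    show "AE z in N. (\<lambda>n. \<phi> n (\<kappa> z) * h z) \<longlonglongrightarrow> h z"
      using tendsto_mult[OF \<phi>_lim tendsto_const] by (intro AE_I2) simp
  qed (auto simp: abs_mult \<phi>_abs \<phi>_bounds ih)
  have lim_g: "(\<lambda>n. \<integral>z. \<phi> n (Suc (\<kappa> z)) * g z \<partial>N) \<longlonglongrightarrow> (\<integral>z. g z \<partial>N)"
  proof (rule integral_dominated_convergence[where w = "\<lambda>z. \<bar>g z\<bar>"])
    show "AE z in N. (\<lambda>n. \<phi> n (Suc (\<kappa> z)) * g z) \<longlonglongrightarrow> g z"
      using tendsto_mult[OF \<phi>_lim tendsto_const] by (intro AE_I2) simp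
  qed (auto simp: abs_mult \<phi>_abs \<phi>_bounds ig)
  \<comment> \<open>The boundary term: its integrand tends to 0 pointwise and is dominated by the
    integrable \<bar>w\<bar>, uniformly in \<open>n\<close>.\<close>
  have lim_\<delta>: "(\<lambda>n. \<integral>z. (\<phi> n (Suc (\<kappa> z)) - \<phi> n (\<kappa> z)) * v z \<partial>N) \<longlonglongrightarrow> (\<integral>z. 0 \<partial>N)"
  proof (rule integral_dominated_convergence[where w = "\<lambda>z. \<bar>w z\<bar>"])
    show "AE z in N. (\<lambda>n. (\<phi> n (Suc (\<kappa> z)) - \<phi> n (\<kappa> z)) * v z) \<longlonglongrightarrow> 0"
      using tendsto_mult[OF tendsto_diff[OF \<phi>_lim \<phi>_lim] tendsto_const] by (intro AE_I2) simp
  qed (use \<delta>_le iw in auto)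
  have "(\<integral>z. h z \<partial>N) = (\<integral>z. g z \<partial>N) + (\<integral>z. 0 \<partial>N)"
    using tendsto_add[OF lim_g lim_\<delta>] lim_h unfolding parts[symmetric]
    by (rule LIMSEQ_unique[rotated])
  then show ?thesis by (simp add: h_def g_def)
qed

section \<open>Product measures and the channel law\<close>

text \<open>Points of \<open>{0..}\<close> accumulate at \<open>t\<close> from the right, also when
  \<open>t = 0\<close>, so a limit within this set is unique. This identifies the unspecified
  derivatives supplied by the regularity conditions with explicit formulas.\<close>

lemma has_real_derivative_atLeast_unique:
  fixes f :: "real \<Rightarrow> real"
  assumes "(f has_real_derivative d) (at t within {0..})"
    and "(f has_real_derivative d') (at t within {0..})" and "0 \<le> t"
  shows "d = d'"
proof (rule tendsto_unique)
  have "at_right t \<le> at t within {0..}"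
    using assms(3) by (intro at_le) auto
  then show "at t within {0..} \<noteq> bot"
    by (metis bot.extremum_uniqueI trivial_limit_at_right_real)
qed (use assms in \<open>auto simp: has_field_derivative_iff\<close>)

text \<open>The function is glued together from countably many slices, one for each value of the
  discrete coordinate.\<close>

lemma measurable_pair_count_space:
  assumes "countable (UNIV :: 'b set)" "\<And>y :: 'b. (\<lambda>x. f (x, y)) \<in> M \<rightarrow>\<^sub>M K"
  shows "f \<in> M \<Otimes>\<^sub>M count_space UNIV \<rightarrow>\<^sub>M K"
proof -
  have "(\<lambda>z. f (fst z, snd z)) \<in> M \<Otimes>\<^sub>M count_space (UNIV :: 'b set) \<rightarrow>\<^sub>M K"
  proof (rule measurable_compose_countable'[where f = "\<lambda>y z. f (fst z, y)" and g = snd and I = UNIV])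
    show "(\<lambda>z. f (fst z, y)) \<in> M \<Otimes>\<^sub>M count_space (UNIV :: 'b set) \<rightarrow>\<^sub>M K" for y :: 'b
      using measurable_compose[OF measurable_fst assms(2)] .
  qed (auto simp: assms(1))
  then show ?thesis by simp
qed

text \<open>The exceptional null set lifts to a cylinder, which stays null even if \<open>N\<close>
  has infinite mass, because 0 times \<infinity> is 0.\<close>

lemma AE_fst_pair_measure:
  assumes "sigma_finite_measure N" "AE x in M. Q x"
  shows "AE z in M \<Otimes>\<^sub>M N. Q (fst z)"
proof -
  interpret N: sigma_finite_measure N by fact
  obtain A where A: "{x \<in> space M. \<not> Q x} \<subseteq> A" "emeasure M A = 0" "A \<in> sets M"
    using AE_E[OF assms(2)] by blast
  show ?thesis
  proof (rule AE_I)
    show "{z \<in> space (M \<Otimes>\<^sub>M N). \<not> Q (fst z)} \<subseteq> A \<times> space N"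
      using A(1) by (auto simp: space_pair_measure)
    show "emeasure (M \<Otimes>\<^sub>M N) (A \<times> space N) = 0"
      using A by (simp add: N.emeasure_pair_measure_Times)
  qed (use A in simp)
qed

text \<open>Tonelli: since \<open>F\<close> is nonnegative, the absolute value of the integrand
  integrates in \<open>x\<close> to the marginal of \<open>F\<close> times \<bar>c y\<bar>. A weight
  depending on \<open>y\<close> alone is thus handled on the output space.\<close>

lemma integrable_pair_weight:
  fixes F :: "'a \<times> 'b \<Rightarrow> real" and c :: "'b \<Rightarrow> real"
  assumes "sigma_finite_measure M" "sigma_finite_measure N"
    and [measurable]: "F \<in> borel_measurable (M \<Otimes>\<^sub>M N)" "c \<in> borel_measurable N"
    and nonneg: "AE x in M. \<forall>y. 0 \<le> F (x, y)"
    and int: "\<And>y. integrable M (\<lambda>x. F (x, y))"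
    and int_c: "integrable N (\<lambda>y. (\<integral>x. F (x, y) \<partial>M) * c y)"
  shows "integrable (M \<Otimes>\<^sub>M N) (\<lambda>z. F z * c (snd z))"
    and "(\<integral>z. F z * c (snd z) \<partial>(M \<Otimes>\<^sub>M N)) = (\<integral>y. (\<integral>x. F (x, y) \<partial>M) * c y \<partial>N)"
proof -
  interpret pair_sigma_finite M N by (intro pair_sigma_finite.intro assms)
  have pos: "0 \<le> (\<integral>x. F (x, y) \<partial>M)" for y
    using nonneg by (intro integral_nonneg_AE) auto
  show I: "integrable (M \<Otimes>\<^sub>M N) (\<lambda>z. F z * c (snd z))"
  proof (rule integrableI_bounded)
    have "(\<integral>\<^sup>+z. ennreal (norm (F z * c (snd z))) \<partial>(M \<Otimes>\<^sub>M N))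
        = (\<integral>\<^sup>+y. (\<integral>\<^sup>+x. ennreal (norm (F (x, y) * c y)) \<partial>M) \<partial>N)"
      by (subst nn_integral_snd[symmetric]) auto
    also have "\<dots> = (\<integral>\<^sup>+y. ennreal (norm ((\<integral>x. F (x, y) \<partial>M) * c y)) \<partial>N)"
    proof (rule nn_integral_cong)
      fix y assume y: "y \<in> space N"
      have [measurable]: "(\<lambda>x. F (x, y)) \<in> borel_measurable M"
        using int[of y] by simp
      have "(\<integral>\<^sup>+x. ennreal (norm (F (x, y) * c y)) \<partial>M) = (\<integral>\<^sup>+x. ennreal (F (x, y)) * ennreal \<bar>c y\<bar> \<partial>M)"
        using nonneg by (intro nn_integral_cong_AE) (auto simp: abs_mult ennreal_mult)
      also have "\<dots> = (\<integral>\<^sup>+x. ennreal (F (x, y)) \<partial>M) * ennreal \<bar>c y\<bar>"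
        by (rule nn_integral_multc) simp
      also have "(\<integral>\<^sup>+x. ennreal (F (x, y)) \<partial>M) = ennreal (\<integral>x. F (x, y) \<partial>M)"
        using nonneg by (intro nn_integral_eq_integral int) auto
      finally show "(\<integral>\<^sup>+x. ennreal (norm (F (x, y) * c y)) \<partial>M) = ennreal (norm ((\<integral>x. F (x, y) \<partial>M) * c y))"
        using pos by (simp add: abs_mult ennreal_mult)
    qed
    also have "\<dots> < \<infinity>" using int_c by (simp add: integrable_iff_bounded)
    finally show "(\<integral>\<^sup>+z. ennreal (norm (F z * c (snd z))) \<partial>(M \<Otimes>\<^sub>M N)) < \<infinity>" .
  qed measurable
  have "(\<integral>z. F z * c (snd z) \<partial>(M \<Otimes>\<^sub>M N)) = (\<integral>y. (\<integral>x. F (x, y) * c y \<partial>M) \<partial>N)"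
    using integral_snd[of "\<lambda>x y. F (x, y) * c y"] I by (simp add: case_prod_beta')
  then show "(\<integral>z. F z * c (snd z) \<partial>(M \<Otimes>\<^sub>M N)) = (\<integral>y. (\<integral>x. F (x, y) \<partial>M) * c y \<partial>N)"
    by simp
qed

lemma integrable_pair_weightD:
  fixes F :: "'a \<times> 'b \<Rightarrow> real" and c :: "'b \<Rightarrow> real"
  assumes "sigma_finite_measure M" "sigma_finite_measure N"
    and "integrable (M \<Otimes>\<^sub>M N) (\<lambda>z. F z * c (snd z))"
  shows "integrable N (\<lambda>y. (\<integral>x. F (x, y) \<partial>M) * c y)"
proof -
  interpret pair_sigma_finite M N by (intro pair_sigma_finite.intro assms)
  show ?thesis
    using integrable_snd[of "\<lambda>x y. F (x, y) * c y"] assms(3) by (simp add: case_prod_beta')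
qed

section \<open>The unit shift of one output coordinate\<close>

definition bump :: "'m \<Rightarrow> nat^'m \<Rightarrow> nat^'m" where
  "bump i y = (\<chi> k. if k = i then Suc (y $ k) else y $ k)"

lemma bump_nth [simp]: "bump i y $ k = (if k = i then Suc (y $ k) else y $ k)"
  by (simp add: bump_def)

lemma bump_surj:
  assumes "y $ i = Suc n"
  obtains y' where "y = bump i y'" "y' $ i = n"
proof
  show "y = bump i (\<chi> k. if k = i then n else y $ k)"
    using assms by (auto simp: vec_eq_iff)
qed simp

lemma bij_betw_bump: "bij_betw (bump i) UNIV {y. 0 < y $ i}"
proof (rule bij_betwI')
  show "(bump i x = bump i y) = (x = y)" for x y
    unfolding vec_eq_iff by (metis bump_nth nat.inject)
  show "\<exists>x\<in>UNIV. y = bump i x" if "y \<in> {y. 0 < y $ i}" for y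
    using that bump_surj[of y i "y $ i - 1"] by fastforce
qed auto

lemma sigma_finite_count_space_vec: "sigma_finite_measure (count_space (UNIV :: (nat^'m) set))"
  by (rule sigma_finite_measure_count_space_countable) simp

text \<open>For fixed \<open>x\<close> the shift is a bijection onto the outputs with positive
  \<open>i\<close>-th coordinate, so it carries counting measure to counting measure on that set;
  Tonelli then adds the input. This provides \<open>distr_T\<close> in
  \<open>shift_by_parts\<close>.\<close>

lemma distr_bump:
  fixes M :: "'a measure" and i :: "'m :: finite"
  defines "N \<equiv> M \<Otimes>\<^sub>M count_space (UNIV :: (nat^'m) set)"
  shows "distr N N (\<lambda>z. (fst z, bump i (snd z))) = density N (\<lambda>z. ennreal (of_bool (0 < snd z $ i)))"
    (is "?L = ?R")
proof (rule measure_eqI)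
  interpret C: sigma_finite_measure "count_space (UNIV :: (nat^'m) set)"
    by (rule sigma_finite_count_space_vec)
  have sn [measurable]: "(\<lambda>z. bump i (snd z)) \<in> N \<rightarrow>\<^sub>M count_space UNIV"
    "(\<lambda>z. snd z $ i) \<in> N \<rightarrow>\<^sub>M count_space UNIV" "snd \<in> N \<rightarrow>\<^sub>M count_space UNIV"
      "fst \<in> N \<rightarrow>\<^sub>M M"
    unfolding N_def by measurable
  have [measurable]: "(\<lambda>z. (fst z, bump i (snd z))) \<in> N \<rightarrow>\<^sub>M N"
    by (subst (2) N_def) measurable
  fix A assume "A \<in> sets ?L"
  then have A [measurable]: "A \<in> sets N" by simp
  have "emeasure ?L A = (\<integral>\<^sup>+z. indicator A z \<partial>?L)"
    using A by simp
  also have "\<dots> = (\<integral>\<^sup>+z. indicator A (fst z, bump i (snd z)) \<partial>N)"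
    by (subst nn_integral_distr) auto
  also have "\<dots> = (\<integral>\<^sup>+x. (\<integral>\<^sup>+y. indicator A (x, bump i y) \<partial>count_space UNIV) \<partial>M)"
    unfolding N_def by (subst C.nn_integral_fst[symmetric]) (auto simp flip: N_def)
  also have "\<dots> = (\<integral>\<^sup>+x. (\<integral>\<^sup>+y. indicator A (x, y) \<partial>count_space {y. 0 < y $ i}) \<partial>M)"
    by (subst nn_integral_bij_count_space[OF bij_betw_bump]) rule
  also have "\<dots> = (\<integral>\<^sup>+x. (\<integral>\<^sup>+y. ennreal (of_bool (0 < y $ i)) * indicator A (x, y) \<partial>count_space UNIV) \<partial>M)"
    by (subst nn_integral_count_space_indicator)
       (auto intro!: nn_integral_cong simp: indicator_def)
  also have "\<dots> = (\<integral>\<^sup>+z. ennreal (of_bool (0 < snd z $ i)) * indicator A z \<partial>N)"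
    unfolding N_def by (subst C.nn_integral_fst[symmetric]) (auto simp flip: N_def)
  also have "\<dots> = emeasure ?R A"
    by (subst emeasure_density) auto
  finally show "emeasure ?L A = emeasure ?R A" .
qed simp

section \<open>The channel law as a probability mass function\<close>

lemma channel_prob_eq_pmf:
  fixes y :: "nat^'m"
  shows "channel_prob \<Phi> lam x y =
     pmf (map_pmf vec_lambda (Pi_pmf UNIV 0 (\<lambda>k. pois (channel_rate \<Phi> lam x k)))) y"
proof -
  have "inj (vec_lambda :: ('m \<Rightarrow> nat) \<Rightarrow> nat^'m)"
    by (metis injI vec_lambda_inverse UNIV_I)
  then have "pmf (map_pmf vec_lambda (Pi_pmf UNIV 0 (\<lambda>k. pois (channel_rate \<Phi> lam x k)))) (vec_lambda (vec_nth y))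
      = channel_prob \<Phi> lam x y"
    by (subst pmf_map_inj') (auto simp: pmf_Pi channel_prob_def)
  then show ?thesis by simp
qed

lemma channel_prob_nonneg: "0 \<le> channel_prob \<Phi> lam x y"
  by (simp add: channel_prob_eq_pmf)

lemma channel_prob_le_1: "channel_prob \<Phi> lam x y \<le> 1"
  by (simp add: channel_prob_eq_pmf pmf_le_1)

text \<open>The total mass of a pmf. It is 1 for every \<open>x\<close>, even one giving a negative
  rate, because \<open>pois\<close> is then the point mass at 0.\<close>

lemma nn_integral_channel_prob:
  "(\<integral>\<^sup>+y. ennreal (channel_prob \<Phi> lam x y) \<partial>count_space UNIV) = 1"
  unfolding channel_prob_eq_pmf nn_integral_pmf
  by (metis measure_pmf.emeasure_space_1 space_measure_pmf)

lemma borel_measurable_channel_rate [measurable]: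
  "(\<lambda>x. channel_rate \<Phi> lam x k) \<in> borel_measurable borel"
  unfolding channel_rate_def matrix_vector_mult_def
  by (intro borel_measurable_continuous_onI) (auto intro!: continuous_intros)

lemma borel_measurable_pmf_pois [measurable]: "(\<lambda>z. pmf (pois z) k) \<in> borel_measurable borel"
proof -
  have "(\<lambda>z. pmf (pois z) k) = (\<lambda>z. if 0 < z then z ^ k / fact k * exp (- z) else of_bool (k = 0))"
    by (auto simp: pois_def fun_eq_iff indicator_def)
  then show ?thesis by simp
qed

lemma borel_measurable_channel_prob [measurable]:
  "(\<lambda>x. channel_prob \<Phi> lam x y) \<in> borel_measurable borel"
  unfolding channel_prob_def by measurable

lemma output_prob_nonneg: "0 \<le> output_prob D \<Phi> lam y"
  unfolding output_prob_def by (intro integral_nonneg_AE) (simp add: channel_prob_nonneg)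

text \<open>Only the factor \<open>i\<close> moves, and the Poisson weights satisfy (k + 1) w(k + 1)
  = z w(k), also for z = 0.\<close>

lemma channel_prob_bump:
  assumes "\<And>k. 0 \<le> channel_rate \<Phi> lam x k"
  shows "channel_prob \<Phi> lam x (bump i y) * (real (y $ i) + 1) = channel_rate \<Phi> lam x i * channel_prob \<Phi> lam x y"
proof -
  have rest: "(\<Prod>k\<in>UNIV - {i}. pmf (pois (channel_rate \<Phi> lam x k)) (bump i y $ k)) =
      (\<Prod>k\<in>UNIV - {i}. pmf (pois (channel_rate \<Phi> lam x k)) (y $ k))"
    by (intro prod.cong) auto
  have "pmf (pois (channel_rate \<Phi> lam x i)) (bump i y $ i) * (real (y $ i) + 1)
      = channel_rate \<Phi> lam x i * pmf (pois (channel_rate \<Phi> lam x i)) (y $ i)"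
  proof -
    have *: "r * P / (c * F) * E * c = r * (P / F * E)" if "F \<noteq> 0" "c \<noteq> 0" for r P c F E :: real
      using that by (simp add: field_simps)
    show ?thesis
      using assms *[of "fact (y $ i)" "real (y $ i) + 1"] by (simp add: pmf_pois add.commute)
  qed
  then show ?thesis
    unfolding channel_prob_def by (simp add: prod.remove[of UNIV i] rest del: bump_nth)
qed

section \<open>The joint law of input and output as a density\<close>

locale channel_input = prob_space D for D :: "(real^'n) measure" +
  assumes sets_D [measurable_cong]: "sets D = sets borel"
begin

abbreviation (input) base_space :: "((real^'n) \<times> (nat^'m)) measure" where
  "base_space \<equiv> D \<Otimes>\<^sub>M count_space UNIV"

lemma space_D [simp]: "space D = UNIV"
  using sets_eq_imp_space_eq[OF sets_D] by simp

lemma sigma_finite_D: "sigma_finite_measure D"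
  by unfold_locales

lemma pair_sigma_finite_base: "pair_sigma_finite D (count_space (UNIV :: (nat^'m) set))"
  by (intro pair_sigma_finite.intro sigma_finite_count_space_vec sigma_finite_D)

lemma measurable_base:
  fixes f :: "(real^'n) \<times> (nat^'m) \<Rightarrow> real"
  assumes "\<And>y. (\<lambda>x. f (x, y)) \<in> borel_measurable borel"
  shows "f \<in> borel_measurable base_space"
proof (rule measurable_pair_count_space)
  show "(\<lambda>x. f (x, y)) \<in> borel_measurable D" for y
    using assms[of y] by measurable
qed simp

lemma integrable_channel_prob: "integrable D (\<lambda>x. channel_prob \<Phi> lam x y)"
  by (rule integrable_const_bound[where B = 1]) (auto simp: channel_prob_nonneg channel_prob_le_1)

lemma nn_integral_channel_prob_input:
  "(\<integral>\<^sup>+x. ennreal (channel_prob \<Phi> lam x y) \<partial>D) = ennreal (output_prob D \<Phi> lam y)"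
  unfolding output_prob_def
  by (rule nn_integral_eq_integral) (auto simp: channel_prob_nonneg integrable_channel_prob)

lemma measurable_channel_prob_base [measurable]:
  "(\<lambda>z. channel_prob \<Phi> lam (fst z) (snd z)) \<in> borel_measurable base_space"
  by (rule measurable_base) simp

lemma channel_eq:
  "channel D \<Phi> lam = density base_space (\<lambda>z. ennreal (channel_prob \<Phi> lam (fst z) (snd z)))"
  by (simp add: channel_def case_prod_beta')

lemma sets_channel [measurable_cong]: "sets (channel D \<Phi> lam) = sets base_space"
  by (simp add: channel_eq)

lemma space_channel [simp]: "space (channel D \<Phi> lam) = UNIV"
  by (simp add: channel_eq space_pair_measure)

lemma nn_integral_channel:
  assumes [measurable]: "f \<in> borel_measurable base_space"
  shows "(\<integral>\<^sup>+z. f z \<partial>channel D \<Phi> lam) =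
    (\<integral>\<^sup>+z. ennreal (channel_prob \<Phi> lam (fst z) (snd z)) * f z \<partial>base_space)"
  unfolding channel_eq by (subst nn_integral_density) auto

lemma nn_integral_channel_prob_base:
  fixes lam :: "real^'m"
  shows "(\<integral>\<^sup>+z. ennreal (channel_prob \<Phi> lam (fst z) (snd z)) \<partial>base_space) = 1"
proof -
  interpret pair_sigma_finite D "count_space (UNIV :: (nat^'m) set)"
    by (rule pair_sigma_finite_base)
  show ?thesis
    by (subst M2.nn_integral_fst[symmetric])
       (auto simp: nn_integral_channel_prob emeasure_space_1[simplified])
qed

lemma prob_space_channel: "prob_space (channel D \<Phi> lam)"
proof (rule prob_spaceI)
  have "emeasure (channel D \<Phi> lam) (space (channel D \<Phi> lam)) = (\<integral>\<^sup>+z. 1 \<partial>channel D \<Phi> lam)"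
    by simp
  also have "\<dots> = 1"
    by (subst nn_integral_channel) (auto simp: nn_integral_channel_prob_base)
  finally show "emeasure (channel D \<Phi> lam) (space (channel D \<Phi> lam)) = 1" .
qed

lemma integrable_channel_iff:
  fixes f :: "(real^'n) \<times> (nat^'m) \<Rightarrow> real"
  assumes "f \<in> borel_measurable base_space"
  shows "integrable (channel D \<Phi> lam) f \<longleftrightarrow>
    integrable base_space (\<lambda>z. channel_prob \<Phi> lam (fst z) (snd z) * f z)"
  unfolding channel_eq by (subst integrable_density) (auto simp: assms channel_prob_nonneg)

lemma integral_channel:
  fixes f :: "(real^'n) \<times> (nat^'m) \<Rightarrow> real"
  assumes "f \<in> borel_measurable base_space"
  shows "(\<integral>z. f z \<partial>channel D \<Phi> lam) =
    (\<integral>z. channel_prob \<Phi> lam (fst z) (snd z) * f z \<partial>base_space)"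
  unfolding channel_eq by (subst integral_density) (auto simp: assms channel_prob_nonneg)

section \<open>Mutual information and conditional expectation through densities\<close>

lemma mutual_info_eq:
  fixes lam :: "real^'m"
  shows "mutual_info D \<Phi> lam = (\<integral>z. (case z of (x, y) \<Rightarrow> channel_prob \<Phi> lam x y *
          ln (channel_prob \<Phi> lam x y / output_prob D \<Phi> lam y)) \<partial>base_space)"
proof -
  let ?J = "channel D \<Phi> lam" and ?C = "count_space (UNIV :: (nat^'m) set)"
  interpret J: prob_space ?J by (rule prob_space_channel)
  interpret J: information_space ?J "exp 1"
    by unfold_locales simp
  interpret pair_sigma_finite D ?C
    by (rule pair_sigma_finite_base)
  have fst_J: "fst \<in> ?J \<rightarrow>\<^sub>M D" and snd_J: "snd \<in> ?J \<rightarrow>\<^sub>M ?C" by measurable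
  \<comment> \<open>Relative to \<open>D\<close>, counting measure and their product, the input has
    density 1, the output \<open>output_prob\<close>, and the pair \<open>channel_prob\<close>. The
    mutual information is then the integral of the joint density times the log of the density
    ratio.\<close>
  have "distributed ?J D fst (\<lambda>x. ennreal 1)"
  proof -
    have "distr ?J D fst = density D (\<lambda>x. ennreal 1)"
    proof (rule measure_eqI)
      fix A assume "A \<in> sets (distr ?J D fst)"
      then have [measurable]: "A \<in> sets D" by simp
      have "emeasure (distr ?J D fst) A = (\<integral>\<^sup>+z. indicator A (fst z) \<partial>?J)"
        by (subst nn_integral_distr[OF fst_J, symmetric]) auto
      also have "\<dots> = (\<integral>\<^sup>+x. (\<integral>\<^sup>+y. ennreal (channel_prob \<Phi> lam x y) * indicator A x \<partial>?C) \<partial>D)"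
        by (subst nn_integral_channel) (auto simp: M2.nn_integral_fst[symmetric])
      also have "\<dots> = (\<integral>\<^sup>+x. indicator A x \<partial>D)"
        by (simp add: nn_integral_multc nn_integral_channel_prob)
      finally show "emeasure (distr ?J D fst) A = emeasure (density D (\<lambda>x. ennreal 1)) A"
        by (simp add: emeasure_density)
    qed simp
    then show ?thesis by (simp add: distributed_def fst_J)
  qed
  moreover have "distributed ?J ?C snd (\<lambda>y. ennreal (output_prob D \<Phi> lam y))"
  proof -
    have "distr ?J ?C snd = density ?C (\<lambda>y. ennreal (output_prob D \<Phi> lam y))"
    proof (rule measure_eqI)
      fix B
      have "emeasure (distr ?J ?C snd) B = (\<integral>\<^sup>+z. indicator B (snd z) \<partial>?J)"
        by (subst nn_integral_distr[OF snd_J, symmetric]) auto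
      also have "\<dots> = (\<integral>\<^sup>+y. (\<integral>\<^sup>+x. ennreal (channel_prob \<Phi> lam x y) * indicator B y \<partial>D) \<partial>?C)"
        by (subst nn_integral_channel) (auto simp: nn_integral_snd[symmetric])
      also have "\<dots> = (\<integral>\<^sup>+y. ennreal (output_prob D \<Phi> lam y) * indicator B y \<partial>?C)"
        by (simp add: nn_integral_multc nn_integral_channel_prob_input)
      finally show "emeasure (distr ?J ?C snd) B =
          emeasure (density ?C (\<lambda>y. ennreal (output_prob D \<Phi> lam y))) B"
        by (simp add: emeasure_density)
    qed simp
    then show ?thesis by (simp add: distributed_def snd_J)
  qed
  moreover have "distributed ?J (D \<Otimes>\<^sub>M ?C) (\<lambda>z. (fst z, snd z))
      (\<lambda>z. ennreal (channel_prob \<Phi> lam (fst z) (snd z)))"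
  proof -
    have "distr ?J (D \<Otimes>\<^sub>M ?C) (\<lambda>z. z) = ?J"
      by (rule distr_id2) (simp add: sets_channel)
    then show ?thesis by (simp add: distributed_def channel_eq)
  qed
  ultimately have "J.mutual_information (exp 1) D ?C fst snd = (\<integral>z. channel_prob \<Phi> lam (fst z) (snd z) *
      log (exp 1) (channel_prob \<Phi> lam (fst z) (snd z) / (1 * output_prob D \<Phi> lam (snd z))) \<partial>base_space)"
    by (intro J.mutual_information_distr)
       (auto simp: channel_prob_nonneg output_prob_nonneg sigma_finite_count_space_vec sigma_finite_D)
  \<comment> \<open>\<open>mutual_info\<close> takes \<open>borel\<close> as the space of the input.
    It has the same sets as \<open>D\<close>, so the image measures agree.\<close>
  moreover have "distr ?J borel fst = distr ?J D fst"
    by (rule distr_cong) (auto simp: sets_D)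
  moreover have "sets (borel \<Otimes>\<^sub>M ?C) = sets (D \<Otimes>\<^sub>M ?C)"
    by (rule sets_pair_measure_cong) (auto simp: sets_D)
  then have "distr ?J (borel \<Otimes>\<^sub>M ?C) (\<lambda>z. (fst z, snd z)) = distr ?J (D \<Otimes>\<^sub>M ?C) (\<lambda>z. (fst z, snd z))"
    by (rule distr_cong[OF refl]) auto
  ultimately show ?thesis
    by (simp add: mutual_info_def J.mutual_information_def log_def case_prod_beta')
qed

text \<open>A nonnegative integrand with zero integral vanishes almost everywhere; as there are
  countably many outputs, one null set serves all \<open>y\<close>.\<close>

lemma AE_channel_prob_0_of_output_prob_0:
  fixes lam :: "real^'m"
  shows "AE x in D. \<forall>y. output_prob D \<Phi> lam y = 0 \<longrightarrow> channel_prob \<Phi> lam x y = 0"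
proof (subst AE_all_countable, rule allI)
  fix y :: "nat^'m"
  show "AE x in D. output_prob D \<Phi> lam y = 0 \<longrightarrow> channel_prob \<Phi> lam x y = 0"
  proof (cases "output_prob D \<Phi> lam y = 0")
    case True
    then have "AE x in D. channel_prob \<Phi> lam x y = 0"
      unfolding output_prob_def
      by (subst (asm) integral_nonneg_eq_0_iff_AE) (auto simp: integrable_channel_prob channel_prob_nonneg)
    then show ?thesis by eventually_elim simp
  qed simp
qed

text \<open>Bayes' formula. Integrability of \<open>f\<close> under the joint law is not assumed, so
  the nonnegative conditional expectations of the positive and negative parts of \<open>f\<close>
  are characterised separately, and the latter is 0.\<close>

lemma cond_exp_output_eq:
  fixes lam :: "real^'m" and f :: "real^'n \<Rightarrow> real"
  assumes [measurable]: "f \<in> borel_measurable borel"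
    and nonneg: "AE x in D. 0 \<le> f x"
    and int: "\<And>y. integrable D (\<lambda>x. channel_prob \<Phi> lam x y * f x)"
  shows "AE z in channel D \<Phi> lam. cond_exp_output (channel D \<Phi> lam) (\<lambda>\<omega>. f (fst \<omega>)) z =
    (\<integral>x. channel_prob \<Phi> lam x (snd z) * f x \<partial>D) / output_prob D \<Phi> lam (snd z)"
proof -
  let ?J = "channel D \<Phi> lam" and ?C = "count_space (UNIV :: (nat^'m) set)"
  define F where "F = vimage_algebra (space ?J) snd ?C"
  interpret J: prob_space ?J by (rule prob_space_channel)
  interpret pair_sigma_finite D ?C
    by (rule pair_sigma_finite_base)
  have sets_F: "sets F = range (\<lambda>B. snd -` B)"
    by (auto simp: F_def sets_vimage_algebra2)
  have "subalgebra ?J F"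
    unfolding subalgebra_def
  proof
    show "sets F \<subseteq> sets ?J"
    proof
      fix A assume "A \<in> sets F"
      then obtain B where A: "A = snd -` B" by (auto simp: sets_F)
      have "snd \<in> ?J \<rightarrow>\<^sub>M ?C" by measurable
      then have "snd -` B \<inter> space ?J \<in> sets ?J"
        by (rule measurable_sets) simp
      then show "A \<in> sets ?J" by (simp add: A)
    qed
  qed (simp add: F_def)
  then interpret finite_measure_subalgebra ?J F
    by unfold_locales
  define m where "m = (\<lambda>y. (\<integral>x. channel_prob \<Phi> lam x y * f x \<partial>D) / output_prob D \<Phi> lam y)"
  have snd_F: "snd \<in> F \<rightarrow>\<^sub>M ?C"
    unfolding F_def by (rule measurable_vimage_algebra1) auto
  have [measurable]: "(\<lambda>z. f (fst z)) \<in> borel_measurable base_space"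
    by (rule measurable_base) simp
  have pos: "0 \<le> (\<integral>x. channel_prob \<Phi> lam x y * f x \<partial>D)" for y
    using nonneg by (intro integral_nonneg_AE) (auto simp: channel_prob_nonneg)
  have m_nonneg: "0 \<le> m y" for y
    by (simp add: m_def pos output_prob_nonneg)
  \<comment> \<open>Where \<open>output_prob\<close> is 0 the quotient \<open>m\<close> is 0 by
    convention; the right side is 0 there too, because \<open>channel_prob\<close> vanishes almost
    everywhere.\<close>
  have m_eq: "ennreal (output_prob D \<Phi> lam y) * ennreal (m y) =
      (\<integral>\<^sup>+x. ennreal (channel_prob \<Phi> lam x y) * ennreal (f x) \<partial>D)" for y
  proof -
    have "(\<integral>\<^sup>+x. ennreal (channel_prob \<Phi> lam x y) * ennreal (f x) \<partial>D) =
        (\<integral>\<^sup>+x. ennreal (channel_prob \<Phi> lam x y * f x) \<partial>D)"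
      by (simp add: ennreal_mult' channel_prob_nonneg)
    also have "\<dots> = ennreal (\<integral>x. channel_prob \<Phi> lam x y * f x \<partial>D)"
      using nonneg by (intro nn_integral_eq_integral int) (auto simp: channel_prob_nonneg)
    also have "(\<integral>x. channel_prob \<Phi> lam x y * f x \<partial>D) = output_prob D \<Phi> lam y * m y"
    proof (cases "output_prob D \<Phi> lam y = 0")
      case True
      have "(\<integral>x. channel_prob \<Phi> lam x y * f x \<partial>D) = (\<integral>x. 0 \<partial>D)"
        using AE_channel_prob_0_of_output_prob_0[of \<Phi> lam] True
        by (intro integral_cong_AE) auto
      with True show ?thesis by simp
    qed (simp add: m_def)
    finally show ?thesis by (simp add: ennreal_mult' output_prob_nonneg)
  qed
  have 1: "AE z in ?J. ennreal (m (snd z)) = nn_cond_exp ?J F (\<lambda>z. ennreal (f (fst z))) z"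
  proof (rule nn_cond_exp_charact)
    fix A assume "A \<in> sets F"
    then obtain B where A: "A = snd -` B" by (auto simp: sets_F)
    have A': "indicator A = (\<lambda>z. indicator B (snd z))"
      by (auto simp: A indicator_def fun_eq_iff)
    have "(\<integral>\<^sup>+z\<in>A. ennreal (f (fst z)) \<partial>?J) =
        (\<integral>\<^sup>+y. (\<integral>\<^sup>+x. ennreal (channel_prob \<Phi> lam x y) * (ennreal (f x) * indicator B y) \<partial>D) \<partial>?C)"
      unfolding A' by (subst nn_integral_channel) (auto simp: nn_integral_snd[symmetric])
    also have "\<dots> = (\<integral>\<^sup>+y. (\<integral>\<^sup>+x. ennreal (channel_prob \<Phi> lam x y) * (ennreal (m y) * indicator B y) \<partial>D) \<partial>?C)"
      by (simp add: mult.assoc[symmetric] nn_integral_multc m_eq[symmetric] nn_integral_channel_prob_input)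
    also have "\<dots> = (\<integral>\<^sup>+z\<in>A. ennreal (m (snd z)) \<partial>?J)"
      unfolding A' by (subst nn_integral_channel) (auto simp: nn_integral_snd[symmetric])
    finally show "(\<integral>\<^sup>+z\<in>A. ennreal (f (fst z)) \<partial>?J) = (\<integral>\<^sup>+z\<in>A. ennreal (m (snd z)) \<partial>?J)" .
  next
    show "(\<lambda>z. ennreal (m (snd z))) \<in> borel_measurable F"
      by (rule measurable_compose[OF snd_F]) simp
  qed measurable
  have f_J: "AE z in ?J. 0 \<le> f (fst z)"
  proof -
    have "AE z in (base_space :: ((real^'n) \<times> (nat^'m)) measure). 0 \<le> f (fst z)"
      by (rule AE_fst_pair_measure) (use nonneg sigma_finite_count_space_vec in auto)
    then show ?thesis
      unfolding channel_eq by (subst AE_density) auto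
  qed
  have 2: "AE z in ?J. (0::ennreal) = nn_cond_exp ?J F (\<lambda>z. ennreal (- f (fst z))) z"
  proof (rule nn_cond_exp_charact)
    fix A
    have "(\<integral>\<^sup>+z\<in>A. ennreal (- f (fst z)) \<partial>?J) = (\<integral>\<^sup>+z. 0 \<partial>?J)"
      using f_J by (intro nn_integral_cong_AE) (auto simp: ennreal_neg)
    then show "(\<integral>\<^sup>+z\<in>A. ennreal (- f (fst z)) \<partial>?J) = (\<integral>\<^sup>+z\<in>A. 0 \<partial>?J)"
      by simp
  qed measurable
  show ?thesis
    using 1 2
  proof eventually_elim
    case (elim z)
    then show ?case
      unfolding cond_exp_output_def F_def[symmetric] real_cond_exp_def
      by (simp add: elim[symmetric] m_nonneg) (simp add: m_def)
  qed
qed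

end

section \<open>Differentiation along a path of channels\<close>

text \<open>Common setting of both gradients: only the \<open>i\<close>-th rate moves, and it is
  affine in the parameter with slope \<open>a x\<close>. The base point \<open>t\<close> is the
  entry of \<Phi> or of \<open>lam\<close> being varied.\<close>

locale channel_path = channel_input D for D :: "(real^'n) measure" +
  fixes P :: "real \<Rightarrow> real^'n^'m" and l :: "real \<Rightarrow> real^'m" and t :: real
    and i :: 'm and a :: "real^'n \<Rightarrow> real"
  assumes t_nonneg: "0 \<le> t"
    and a_measurable [measurable]: "a \<in> borel_measurable borel"
    and a_nonneg: "AE x in D. 0 \<le> a x"
    and rate_path: "\<And>s x k. channel_rate (P s) (l s) x k =
      channel_rate (P t) (l t) x k + (if k = i then (s - t) * a x else 0)"
    and rate_nonneg: "\<And>s. 0 \<le> s \<Longrightarrow> AE x in D. \<forall>k. 0 \<le> channel_rate (P s) (l s) x k"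
    and regular: "regular_at D P l t"
    and log_rate: "log_expectation_finite (channel D (P t) (l t)) (\<lambda>\<omega>. a (fst \<omega>))
      (\<lambda>\<omega>. channel_rate (P t) (l t) (fst \<omega>) i)"
begin

abbreviation "p s x y \<equiv> channel_prob (P s) (l s) x y"
abbreviation "q s y \<equiv> output_prob D (P s) (l s) y"
abbreviation "r x \<equiv> channel_rate (P t) (l t) x i"

text \<open>The weight times its Poisson score, to be shown to be the derivative of \<open>p\<close>
  at \<open>t\<close>. Where \<open>r x = 0\<close> it reduces to \<open>- p a\<close>, which is 0
  for typical \<open>x\<close>.\<close>

definition p' :: "real^'n \<Rightarrow> nat^'m \<Rightarrow> real" where
  "p' x y = p t x y * (a x * (real (y $ i) / r x - 1))"

definition q' :: "nat^'m \<Rightarrow> real" where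
  "q' y = (\<integral>x. p' x y \<partial>D)"

text \<open>The clause \<open>r x = 0 \<longrightarrow> a x = 0\<close> keeps \<open>p s x y\<close> at \<open>0\<close> along the path wherever \<open>p t x y = 0\<close>.\<close>

definition typical :: "real^'n \<Rightarrow> bool" where
  "typical x \<longleftrightarrow> 0 \<le> a x \<and> (\<forall>k. 0 \<le> channel_rate (P t) (l t) x k) \<and>
    (\<forall>s\<ge>0. 0 \<le> r x + (s - t) * a x) \<and> (r x = 0 \<longrightarrow> a x = 0) \<and>
    (\<forall>y. q t y = 0 \<longrightarrow> p t x y = 0)"

text \<open>The assumption holds almost everywhere under the joint law. Each \<open>x\<close> has
  some output of positive probability, since the masses sum to 1, so a property of \<open>x\<close>
  alone descends to \<open>D\<close>.\<close>

lemma AE_rate_0: "AE x in D. r x = 0 \<longrightarrow> a x = 0"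
proof -
  interpret pair_sigma_finite D "count_space (UNIV :: (nat^'m) set)"
    by (rule pair_sigma_finite_base)
  have "AE z in base_space. 0 < ennreal (p t (fst z) (snd z)) \<longrightarrow> r (fst z) = 0 \<longrightarrow> a (fst z) = 0"
    using log_rate unfolding log_expectation_finite_def channel_eq
    by (subst (asm) AE_density) auto
  then have "AE x in D. AE y in count_space (UNIV :: (nat^'m) set).
      0 < ennreal (p t x y) \<longrightarrow> r x = 0 \<longrightarrow> a x = 0"
    by (drule_tac AE_pair) simp
  then have "AE x in D. \<forall>y. 0 < p t x y \<longrightarrow> r x = 0 \<longrightarrow> a x = 0"
    unfolding AE_count_space by simp
  then show ?thesis
  proof eventually_elim
    case (elim x)
    have "\<exists>y. 0 < p t x y"
    proof (rule ccontr)
      assume "\<nexists>y. 0 < p t x y"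
      then have "p t x y = 0" for y
        using channel_prob_nonneg[of "P t" "l t" x y] by (auto simp: not_less intro: antisym)
      with nn_integral_channel_prob[of "P t" "l t" x] show False by simp
    qed
    with elim show ?case by blast
  qed
qed

lemma AE_typical: "AE x in D. typical x"
  using a_nonneg rate_nonneg[OF t_nonneg] rate_nonneg[OF order_refl] AE_rate_0
    AE_channel_prob_0_of_output_prob_0[of "P t" "l t"]
proof eventually_elim
  case (elim x)
  \<comment> \<open>This must hold for uncountably many \<open>s\<close> off a single null set: the
    rate is nonnegative at \<open>s = 0\<close> and nondecreasing in \<open>s\<close>, because
    \<open>a x\<close> is nonnegative.\<close>
  have "0 \<le> r x + (s - t) * a x" if "0 \<le> s" for s
  proof -
    have "0 \<le> r x + (0 - t) * a x" using elim(3) rate_path[of 0 x i] by (metis (full_types))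
    moreover have "0 \<le> s * a x" using that elim by simp
    ultimately show ?thesis by (simp add: algebra_simps)
  qed
  with elim show ?case unfolding typical_def by blast
qed

lemma p_path:
  assumes "typical x" "0 \<le> s"
  shows "p s x y = (\<Prod>k\<in>UNIV - {i}. pmf (pois (channel_rate (P t) (l t) x k)) (y $ k)) *
    ((r x + (s - t) * a x) ^ (y $ i) / fact (y $ i) * exp (- (r x + (s - t) * a x)))"
proof -
  have "(\<Prod>k\<in>UNIV - {i}. pmf (pois (channel_rate (P s) (l s) x k)) (y $ k)) =
      (\<Prod>k\<in>UNIV - {i}. pmf (pois (channel_rate (P t) (l t) x k)) (y $ k))"
    by (intro prod.cong) (auto simp: rate_path[of s])
  moreover have "pmf (pois (channel_rate (P s) (l s) x i)) (y $ i) =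
      (r x + (s - t) * a x) ^ (y $ i) / fact (y $ i) * exp (- (r x + (s - t) * a x))"
    using assms unfolding rate_path[of s] typical_def by (simp add: pmf_pois)
  ultimately show ?thesis
    unfolding channel_prob_def by (simp add: prod.remove[of UNIV i])
qed

lemma has_derivative_p:
  assumes "typical x"
  shows "((\<lambda>s. p s x y) has_real_derivative p' x y) (at t within {0..})"
proof -
  define K where "K = (\<Prod>k\<in>UNIV - {i}. pmf (pois (channel_rate (P t) (l t) x k)) (y $ k))"
  define n where "n = y $ i"
  have pt: "p t x y = K * (r x ^ n / fact n * exp (- r x))"
    using p_path[OF assms t_nonneg, of y] by (simp add: K_def n_def)
  have "((\<lambda>s. K * ((r x + (s - t) * a x) ^ n / fact n * exp (- (r x + (s - t) * a x)))) has_real_derivative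
      K * ((real n * r x ^ (n - 1) * a x) / fact n * exp (- r x) - r x ^ n / fact n * exp (- r x) * a x))
      (at t within {0..})"
    by (auto intro!: derivative_eq_intros simp: field_simps)
  also have "K * ((real n * r x ^ (n - 1) * a x) / fact n * exp (- r x) - r x ^ n / fact n * exp (- r x) * a x) = p' x y"
  proof (cases "r x = 0")
    case True
    with assms have "a x = 0" by (simp add: typical_def)
    then show ?thesis by (simp add: p'_def)
  next
    case False
    \<comment> \<open>For \<open>n = 0\<close> both sides are 0, so the truncated exponent does no
      harm.\<close>
    have "real n * r x ^ (n - 1) = r x ^ n * (real n / r x)"
      using False by (cases n) auto
    then have "K * ((real n * r x ^ (n - 1) * a x) / fact n * exp (- r x) - r x ^ n / fact n * exp (- r x) * a x)
        = K * ((r x ^ n * (real n / r x) * a x) / fact n * exp (- r x) - r x ^ n / fact n * exp (- r x) * a x)"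
      by simp
    also have "\<dots> = K * (r x ^ n / fact n * exp (- r x)) * (a x * (real n / r x - 1))"
      by (simp add: right_diff_distrib diff_divide_distrib mult_ac)
    also have "\<dots> = p' x y" unfolding p'_def pt n_def ..
    finally show ?thesis .
  qed
  finally show ?thesis
    by (rule has_field_derivative_transform_within[where d = 1])
       (use t_nonneg p_path[OF assms] in \<open>auto simp: K_def n_def\<close>)
qed

text \<open>Either a factor other than the \<open>i\<close>-th is 0, and it does not move, or
  \<open>r x = 0\<close>; then \<open>a x = 0\<close> and the path is constant.\<close>

lemma p_eq_0:
  assumes "typical x" "p t x y = 0" "0 \<le> s"
  shows "p s x y = 0"
proof -
  consider "(\<Prod>k\<in>UNIV - {i}. pmf (pois (channel_rate (P t) (l t) x k)) (y $ k)) = 0"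
    | "r x ^ (y $ i) = 0"
    using p_path[OF assms(1) t_nonneg, of y] assms(2) by auto
  then show ?thesis
  proof cases
    case 1
    then show ?thesis unfolding p_path[OF assms(1,3)] by simp
  next
    case 2
    with assms(1) have "a x = 0" by (auto simp: typical_def)
    then have "p s x y = p t x y"
      using p_path[OF assms(1,3), of y] p_path[OF assms(1) t_nonneg, of y] by simp
    with assms(2) show ?thesis by simp
  qed
qed

section \<open>Derivative of the output law and conservation of mass\<close>

lemma p_pos: "p t x y \<noteq> 0 \<Longrightarrow> 0 < p t x y"
  using channel_prob_nonneg[of "P t" "l t" x y] by linarith

lemma q_pos: "typical x \<Longrightarrow> p t x y \<noteq> 0 \<Longrightarrow> 0 < q t y"
  using output_prob_nonneg[of D "P t" "l t" y] by (auto simp: typical_def less_le)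

lemma p'_measurable [measurable]: "(\<lambda>x. p' x y) \<in> borel_measurable borel"
  unfolding p'_def by measurable

text \<open>Regularity yields some integrable derivative of \<open>p\<close>; by uniqueness it is
  \<open>p'\<close> almost everywhere.\<close>

lemma p'_integrable: "integrable D (\<lambda>x. p' x y)"
  and has_derivative_q: "((\<lambda>s. q s y) has_real_derivative q' y) (at t within {0..})"
proof -
  obtain f' where f': "AE x in D. ((\<lambda>s. p s x y) has_real_derivative f' x) (at t within {0..})"
      "integrable D f'" "((\<lambda>s. q s y) has_real_derivative (\<integral>x. f' x \<partial>D)) (at t within {0..})"
    using regular unfolding regular_at_def interchangeable_def output_prob_def by blast
  have eq: "AE x in D. f' x = p' x y"
    using f'(1) AE_typical
    by eventually_elim (auto intro: has_real_derivative_atLeast_unique[OF _ has_derivative_p t_nonneg])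
  then show "integrable D (\<lambda>x. p' x y)"
    using f'(2) by (subst integrable_cong_AE[symmetric]) auto
  have "(\<integral>x. f' x \<partial>D) = q' y"
    unfolding q'_def using eq f'(2) by (intro integral_cong_AE) auto
  with f'(3) show "((\<lambda>s. q s y) has_real_derivative q' y) (at t within {0..})" by simp
qed

lemma p'_base_measurable [measurable]: "(\<lambda>z. p' (fst z) (snd z)) \<in> borel_measurable base_space"
  by (rule measurable_base) simp

lemma AE_typical_base: "AE z in (base_space :: ((real^'n) \<times> (nat^'m)) measure). typical (fst z)"
  by (rule AE_fst_pair_measure[OF sigma_finite_count_space_vec AE_typical])

text \<open>The total mass equals 1 for every parameter, so exchanging derivative and integral makes
  the integral of \<open>p'\<close> zero.\<close>

lemma p'_base: "integrable base_space (\<lambda>z. p' (fst z) (snd z))"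
    "(\<integral>z. p' (fst z) (snd z) \<partial>base_space) = 0"
proof -
  let ?N = "base_space :: ((real^'n) \<times> (nat^'m)) measure"
  obtain f' where f': "AE z in ?N. ((\<lambda>s. case z of (x, y) \<Rightarrow> p s x y) has_real_derivative f' z) (at t within {0..})"
      "integrable ?N f'"
      "((\<lambda>s. \<integral>z. (case z of (x, y) \<Rightarrow> p s x y) \<partial>?N) has_real_derivative (\<integral>z. f' z \<partial>?N)) (at t within {0..})"
    using regular unfolding regular_at_def interchangeable_def by blast
  have eq: "AE z in ?N. f' z = p' (fst z) (snd z)"
    using f'(1) AE_typical_base
  proof eventually_elim
    case (elim z)
    then show ?case
      using has_real_derivative_atLeast_unique[OF _ has_derivative_p t_nonneg, of "fst z" "snd z"]
      by (simp add: case_prod_beta')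
  qed
  then show "integrable base_space (\<lambda>z. p' (fst z) (snd z))"
    using f'(2) by (subst integrable_cong_AE[symmetric]) auto
  have "(\<integral>z. (case z of (x, y) \<Rightarrow> p s x y) \<partial>?N) = 1" for s
    using nn_integral_channel_prob_base[of "P s" "l s"]
    by (subst integral_eq_nn_integral) (auto simp: channel_prob_nonneg case_prod_beta')
  with f'(3) have "((\<lambda>s. 1) has_real_derivative (\<integral>z. f' z \<partial>?N)) (at t within {0..})" by simp
  then have "(\<integral>z. f' z \<partial>?N) = 0"
    by (rule has_real_derivative_atLeast_unique[OF _ DERIV_const t_nonneg])
  moreover have "(\<integral>z. f' z \<partial>?N) = (\<integral>z. p' (fst z) (snd z) \<partial>base_space)"
    using eq f'(2) by (intro integral_cong_AE) auto
  ultimately show "(\<integral>z. p' (fst z) (snd z) \<partial>base_space) = 0" by simp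
qed

lemma q'_eq_0:
  assumes "q t y = 0"
  shows "q' y = 0"
proof -
  have "AE x in D. p' x y = 0"
    using AE_typical by eventually_elim (simp add: typical_def p'_def assms)
  then have "q' y = (\<integral>x. 0 \<partial>D)"
    unfolding q'_def by (intro integral_cong_AE) auto
  then show ?thesis by simp
qed

text \<open>Integrating out \<open>x\<close> replaces \<open>p\<close> by \<open>q\<close> and
  leaves the sum of \<open>q'\<close>, which is the integral of \<open>p'\<close>. Outputs with
  \<open>q t y = 0\<close> agree with this because \<open>q'\<close> is 0 there.\<close>

lemma score_base:
  "integrable base_space (\<lambda>z. p t (fst z) (snd z) * (q' (snd z) / q t (snd z)))"
  "(\<integral>z. p t (fst z) (snd z) * (q' (snd z) / q t (snd z)) \<partial>base_space) = 0"
proof -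
  let ?C = "count_space (UNIV :: (nat^'m) set)"
  interpret pair_sigma_finite D ?C
    by (rule pair_sigma_finite_base)
  have eq: "(\<integral>x. p t x y \<partial>D) * (q' y / q t y) = q' y" for y
    using q'_eq_0[of y] by (cases "q t y = 0") (auto simp: output_prob_def)
  have iq: "integrable ?C q'" and q0: "(\<integral>y. q' y \<partial>?C) = 0"
    using integrable_snd[of p'] integral_snd[of p'] p'_base
    by (simp_all add: case_prod_beta' q'_def[abs_def])
  note w = integrable_pair_weight[OF sigma_finite_D sigma_finite_count_space_vec,
      where F = "\<lambda>z. p t (fst z) (snd z)" and c = "\<lambda>y. q' y / q t y"]
  show "integrable base_space (\<lambda>z. p t (fst z) (snd z) * (q' (snd z) / q t (snd z)))"
    by (rule w) (use eq iq in \<open>auto simp: channel_prob_nonneg integrable_channel_prob\<close>)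
  show "(\<integral>z. p t (fst z) (snd z) * (q' (snd z) / q t (snd z)) \<partial>base_space) = 0"
    by (subst w) (use eq iq q0 in \<open>auto simp: channel_prob_nonneg integrable_channel_prob\<close>)
qed

section \<open>Shift identities and posterior means\<close>

lemma p_bump: "typical x \<Longrightarrow> p t x (bump i y) * (real (y $ i) + 1) = r x * p t x y"
  by (rule channel_prob_bump) (simp add: typical_def)

lemma p'_bump:
  assumes "typical x"
  shows "p' x (bump i y) = p t x y * a x - p t x (bump i y) * a x"
proof (cases "r x = 0")
  case True
  with assms have "a x = 0" by (simp add: typical_def)
  then show ?thesis by (simp add: p'_def)
next
  case False
  then have "p t x y = p t x (bump i y) * ((real (y $ i) + 1) / r x)"
    using p_bump[OF assms, of y] by (simp add: field_simps)
  then show ?thesis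
    by (simp add: p'_def right_diff_distrib add.commute)
qed

text \<open>Induction on \<open>y $ i\<close>, without assuming \<open>a\<close> integrable: at
  count 0, \<open>p' = - p a\<close>; afterwards \<open>p'_bump\<close> expresses \<open>p a\<close>
  at the shifted output through \<open>p a\<close> at the previous one and the integrable
  \<open>p'\<close>.\<close>

lemma integrable_p_a: "integrable D (\<lambda>x. p t x y * a x)"
proof (induction "y $ i" arbitrary: y)
  case 0
  have "integrable D (\<lambda>x. - p' x y)"
    using p'_integrable by simp
  then show ?case by (simp add: p'_def 0[symmetric])
next
  case (Suc n)
  obtain y' where y': "y = bump i y'" "y' $ i = n"
    using bump_surj[OF Suc.hyps(2)[symmetric]] .
  have "integrable D (\<lambda>x. p t x y' * a x - p' x y)"
    using Suc.hyps(1)[of y'] y' p'_integrable by simp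
  moreover have "AE x in D. p t x y' * a x - p' x y = p t x y * a x"
    using AE_typical by eventually_elim (simp add: y' p'_bump)
  ultimately show ?case
    by (subst integrable_cong_AE[symmetric]) auto
qed

text \<open>By the Poisson recursion \<open>p r\<close> is a multiple of the bounded
  \<open>p\<close> at y + e_i. Divided by \<open>q t y\<close>, the second claim is Robbins' formula
  for the posterior mean of a Poisson rate.\<close>

lemma integrable_p_r: "integrable D (\<lambda>x. p t x y * r x)"
  and integral_p_r: "(\<integral>x. p t x y * r x \<partial>D) = (real (y $ i) + 1) * q t (bump i y)"
proof -
  have eq: "AE x in D. p t x (bump i y) * (real (y $ i) + 1) = p t x y * r x"
    using AE_typical by eventually_elim (simp only: p_bump mult.commute[of "r _"])
  have I: "integrable D (\<lambda>x. p t x (bump i y) * (real (y $ i) + 1))"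
    by (simp add: integrable_channel_prob)
  show "integrable D (\<lambda>x. p t x y * r x)"
    by (rule integrable_cong_AE_imp[OF I _ eq]) measurable
  have "(\<integral>x. p t x y * r x \<partial>D) = (\<integral>x. p t x (bump i y) * (real (y $ i) + 1) \<partial>D)"
    using eq by (intro integral_cong_AE) auto
  then show "(\<integral>x. p t x y * r x \<partial>D) = (real (y $ i) + 1) * q t (bump i y)"
    by (simp add: output_prob_def)
qed

definition post_a :: "nat^'m \<Rightarrow> real" where
  "post_a y = (\<integral>x. p t x y * a x \<partial>D) / q t y"

definition post_r :: "nat^'m \<Rightarrow> real" where
  "post_r y = (\<integral>x. p t x y * r x \<partial>D) / q t y"

text \<open>The information density; it is 0 where \<open>p\<close> or \<open>q\<close> vanishes, as
  \<open>ln 0 = 0\<close>.\<close>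

definition L :: "(real^'n) \<times> (nat^'m) \<Rightarrow> real" where
  "L z = ln (p t (fst z) (snd z) / q t (snd z))"

text \<open>Under the shift \<open>p\<close> is multiplied by r / (y_i + 1) and \<open>q\<close> by
  the posterior mean of \<open>r\<close> over y_i + 1; the denominators cancel in the ratio. The
  condition \<open>a x \<noteq> 0\<close> forces \<open>r x > 0\<close>.\<close>

lemma L_bump:
  assumes "typical x" "p t x y \<noteq> 0" "a x \<noteq> 0"
  shows "L (x, bump i y) - L (x, y) = ln (r x) - ln (post_r y)"
proof -
  have r: "0 < r x"
    using assms by (auto simp: typical_def less_le)
  have p: "0 < p t x y" and q: "0 < q t y"
    using p_pos q_pos assms by auto
  have p1: "p t x (bump i y) = r x * p t x y / (real (y $ i) + 1)"
    using p_bump[OF assms(1), of y] by (auto simp: field_simps)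
  have p1_pos: "0 < p t x (bump i y)"
    unfolding p1 using r p by simp
  have q1: "0 < q t (bump i y)"
    using q_pos[OF assms(1)] p1_pos by simp
  have k: "0 < real (y $ i) + 1" by simp
  have "L (x, bump i y) = ln (r x) + ln (p t x y) - ln (real (y $ i) + 1) - ln (q t (bump i y))"
    unfolding L_def using r p q1 k by (simp add: ln_div ln_mult p1 del: bump_nth)
  moreover have "L (x, y) = ln (p t x y) - ln (q t y)"
    unfolding L_def using p q by (simp add: ln_div)
  moreover have "ln (post_r y) = ln (real (y $ i) + 1) + ln (q t (bump i y)) - ln (q t y)"
    unfolding post_r_def integral_p_r using k q q1 by (simp add: ln_div ln_mult)
  ultimately show ?thesis by simp
qed

section \<open>Derivative of the mutual information\<close>

lemma has_derivative_information:
  assumes "typical x"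
  shows "((\<lambda>s. p s x y * ln (p s x y / q s y)) has_real_derivative
    p' x y * L (x, y) + p' x y - p t x y * (q' y / q t y)) (at t within {0..})"
proof (cases "p t x y = 0")
  case True
  \<comment> \<open>If \<open>p\<close> is 0 at \<open>t\<close> it is 0 along the whole path, so no
    logarithm near 0 has to be differentiated.\<close>
  have "((\<lambda>s. 0) has_real_derivative 0) (at t within {0..})" by simp
  then have "((\<lambda>s. p s x y * ln (p s x y / q s y)) has_real_derivative 0) (at t within {0..})"
    by (rule has_field_derivative_transform_within[where d = 1]) (use t_nonneg p_eq_0[OF assms True] in auto)
  with True show ?thesis by (simp add: p'_def)
next
  case False
  have p: "0 < p t x y" and q: "0 < q t y"
    using p_pos q_pos assms False by auto
  have "((\<lambda>s. p s x y / q s y) has_real_derivative (p' x y * q t y - p t x y * q' y) / (q t y * q t y))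
      (at t within {0..})"
    using q by (intro DERIV_divide has_derivative_p has_derivative_q assms) auto
  then have "((\<lambda>s. ln (p s x y / q s y)) has_real_derivative
      1 / (p t x y / q t y) * ((p' x y * q t y - p t x y * q' y) / (q t y * q t y))) (at t within {0..})"
    by (rule DERIV_chain2[OF DERIV_ln_divide, rotated]) (use p q in simp)
  from DERIV_mult[OF has_derivative_p[OF assms] this]
  show ?thesis
    by (rule DERIV_cong) (use p q in \<open>simp add: L_def field_simps\<close>)
qed

lemma has_derivative_mutual_info:
  assumes log_cond: "log_expectation_finite (channel D (P t) (l t))
      (cond_exp_output (channel D (P t) (l t)) (\<lambda>\<omega>. a (fst \<omega>)))
      (cond_exp_output (channel D (P t) (l t)) (\<lambda>\<omega>. r (fst \<omega>)))"
  shows "((\<lambda>s. mutual_info D (P s) (l s)) has_real_derivative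
      (\<integral>\<omega>. a (fst \<omega>) * ln (r (fst \<omega>)) \<partial>channel D (P t) (l t)) -
      (\<integral>\<omega>. cond_exp_output (channel D (P t) (l t)) (\<lambda>\<omega>. a (fst \<omega>)) \<omega> *
         ln (cond_exp_output (channel D (P t) (l t)) (\<lambda>\<omega>. r (fst \<omega>)) \<omega>) \<partial>channel D (P t) (l t)))
    (at t within {0..})"
proof -
  let ?N = "base_space :: ((real^'n) \<times> (nat^'m)) measure" and ?J = "channel D (P t) (l t)"
  let ?C = "count_space (UNIV :: (nat^'m) set)"
  let ?ea = "cond_exp_output ?J (\<lambda>\<omega>. a (fst \<omega>))" and ?er = "cond_exp_output ?J (\<lambda>\<omega>. r (fst \<omega>))"
  have [measurable]: "L \<in> borel_measurable ?N"
      "(\<lambda>z. post_a (snd z)) \<in> borel_measurable ?N" "(\<lambda>z. post_r (snd z)) \<in> borel_measurable ?N"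
      "(\<lambda>z. q t (snd z)) \<in> borel_measurable ?N" "(\<lambda>z. q' (snd z)) \<in> borel_measurable ?N"
      "(\<lambda>z. a (fst z)) \<in> borel_measurable ?N" "(\<lambda>z. r (fst z)) \<in> borel_measurable ?N"
    unfolding L_def by (rule measurable_base; simp)+
  have ea: "AE z in ?J. ?ea z = post_a (snd z)"
    unfolding post_a_def by (rule cond_exp_output_eq) (auto simp: a_nonneg integrable_p_a)
  have "AE x in D. 0 \<le> r x"
    using AE_typical by eventually_elim (simp add: typical_def)
  then have er: "AE z in ?J. ?er z = post_r (snd z)"
    unfolding post_r_def by (intro cond_exp_output_eq) (auto simp: integrable_p_r)
  have ea_m: "?ea \<in> borel_measurable ?J" and er_m: "?er \<in> borel_measurable ?J"
    unfolding cond_exp_output_def by measurable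
  have e: "AE z in ?J. ?ea z * ln (?er z) = post_a (snd z) * ln (post_r (snd z))"
    using ea er by eventually_elim simp

  have "integrable ?J (\<lambda>z. a (fst z) * ln (r (fst z)))"
    using log_rate unfolding log_expectation_finite_def by simp
  then have int_r: "integrable ?N (\<lambda>z. p t (fst z) (snd z) * (a (fst z) * ln (r (fst z))))"
    by (subst (asm) integrable_channel_iff) auto
  have "integrable ?J (\<lambda>z. ?ea z * ln (?er z))"
    using log_cond unfolding log_expectation_finite_def by simp
  then have "integrable ?J (\<lambda>z. post_a (snd z) * ln (post_r (snd z)))"
    using e ea_m er_m by (subst integrable_cong_AE[symmetric]) auto
  then have "integrable ?N (\<lambda>z. p t (fst z) (snd z) * (post_a (snd z) * ln (post_r (snd z))))"
    by (subst (asm) integrable_channel_iff) auto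
  \<comment> \<open>Fubini brings the hypothesis on the conditional expectations down to a sum over
    outputs.\<close>
  then have int_C: "integrable ?C (\<lambda>y. q t y * (post_a y * ln (post_r y)))"
    using integrable_pair_weightD[OF sigma_finite_D sigma_finite_count_space_vec,
        where F = "\<lambda>z. p t (fst z) (snd z)" and c = "\<lambda>y. post_a y * ln (post_r y)"]
    by (simp add: output_prob_def)
  have post: "(\<integral>x. p t x y * a x \<partial>D) = q t y * post_a y" for y
  proof (cases "q t y = 0")
    case True
    have "AE x in D. p t x y * a x = 0"
      using AE_typical by eventually_elim (simp add: typical_def True)
    then have "(\<integral>x. p t x y * a x \<partial>D) = (\<integral>x. 0 \<partial>D)"
      by (intro integral_cong_AE) auto
    with True show ?thesis by simp
  qed (simp add: post_a_def)
  have pa_nonneg: "AE x in D. \<forall>y. 0 \<le> p t x y * a x"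
    using a_nonneg by eventually_elim (simp add: channel_prob_nonneg)
  note wa = integrable_pair_weight[OF sigma_finite_D sigma_finite_count_space_vec,
      where F = "\<lambda>z. p t (fst z) (snd z) * a (fst z)" and c = "\<lambda>y. ln (post_r y)"]
  \<comment> \<open>Tower property: \<open>ln (post_r y)\<close> depends on \<open>y\<close> only,
    so \<open>p a\<close> may be averaged over \<open>x\<close> first, giving
    \<open>q post_a\<close>.\<close>
  have int_e: "integrable ?N (\<lambda>z. p t (fst z) (snd z) * a (fst z) * ln (post_r (snd z)))"
    by (rule wa) (use int_C pa_nonneg in \<open>auto simp: post integrable_p_a mult.assoc\<close>)
  note wp = integrable_pair_weight[OF sigma_finite_D sigma_finite_count_space_vec,
      where F = "\<lambda>z. p t (fst z) (snd z)" and c = "\<lambda>y. post_a y * ln (post_r y)"]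
  have "(\<integral>z. p t (fst z) (snd z) * a (fst z) * ln (post_r (snd z)) \<partial>?N) =
      (\<integral>y. q t y * (post_a y * ln (post_r y)) \<partial>?C)"
    by (subst wa) (use int_C pa_nonneg in \<open>auto simp: post integrable_p_a mult.assoc\<close>)
  also have "\<dots> = (\<integral>z. p t (fst z) (snd z) * (post_a (snd z) * ln (post_r (snd z))) \<partial>?N)"
    by (subst wp) (use int_C in \<open>auto simp: output_prob_def channel_prob_nonneg integrable_channel_prob\<close>)
  also have "\<dots> = (\<integral>z. post_a (snd z) * ln (post_r (snd z)) \<partial>?J)"
    by (rule integral_channel[symmetric]) simp
  also have "\<dots> = (\<integral>z. ?ea z * ln (?er z) \<partial>?J)"
    using e ea_m er_m by (intro integral_cong_AE) auto
  finally have cond_J: "(\<integral>z. p t (fst z) (snd z) * a (fst z) * ln (post_r (snd z)) \<partial>?N) =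
      (\<integral>z. ?ea z * ln (?er z) \<partial>?J)" .
  have rate_J: "(\<integral>z. p t (fst z) (snd z) * (a (fst z) * ln (r (fst z))) \<partial>?N) =
      (\<integral>z. a (fst z) * ln (r (fst z)) \<partial>?J)"
    by (rule integral_channel[symmetric]) simp

  obtain f' where f': "AE z in ?N. ((\<lambda>s. case z of (x, y) \<Rightarrow> p s x y * ln (p s x y / q s y))
        has_real_derivative f' z) (at t within {0..})"
      "integrable ?N f'"
      "((\<lambda>s. \<integral>z. (case z of (x, y) \<Rightarrow> p s x y * ln (p s x y / q s y)) \<partial>?N)
        has_real_derivative (\<integral>z. f' z \<partial>?N)) (at t within {0..})"
    using regular unfolding regular_at_def interchangeable_def by blast
  define T :: "(real^'n) \<times> (nat^'m) \<Rightarrow> _" where "T = (\<lambda>z. (fst z, bump i (snd z)))"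
  define u where "u = (\<lambda>z :: (real^'n) \<times> (nat^'m). p t (fst z) (snd z) * a (fst z))"
  define h where "h = (\<lambda>z. u z * (real (snd z $ i) / r (fst z) - 1) * L z)"
  define g where "g = (\<lambda>z. u z * (L (T z) - L z))"
  have [measurable]: "T \<in> ?N \<rightarrow>\<^sub>M ?N" "u \<in> borel_measurable ?N"
      "(\<lambda>z. snd z $ i) \<in> ?N \<rightarrow>\<^sub>M count_space UNIV"
    unfolding T_def u_def by measurable
  have [measurable]: "h \<in> borel_measurable ?N" "g \<in> borel_measurable ?N"
    unfolding h_def g_def by measurable

  \<comment> \<open>\<open>h\<close> is the derivative of the integrand corrected by the two terms
    of integral zero, hence integrable with the same integral as \<open>f'\<close>.\<close>
  have f'_eq: "AE z in ?N. f' z - p' (fst z) (snd z) +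
      p t (fst z) (snd z) * (q' (snd z) / q t (snd z)) = h z"
    using f'(1) AE_typical_base
  proof eventually_elim
    case (elim z)
    obtain x y where z: "z = (x, y)" by (cases z)
    have "f' z = p' x y * L (x, y) + p' x y - p t x y * (q' y / q t y)"
      using elim has_real_derivative_atLeast_unique[OF _ has_derivative_information t_nonneg, of x y "f' z"]
      by (simp add: z)
    then show ?case by (simp add: z h_def u_def p'_def mult.assoc)
  qed
  have int_f: "integrable ?N (\<lambda>z. f' z - p' (fst z) (snd z) +
      p t (fst z) (snd z) * (q' (snd z) / q t (snd z)))"
    by (intro Bochner_Integration.integrable_add Bochner_Integration.integrable_diff f' p'_base score_base)
  then have int_h: "integrable ?N h"
    using f'_eq by (subst integrable_cong_AE[symmetric]) auto
  have "(\<integral>z. h z \<partial>?N) = (\<integral>z. f' z - p' (fst z) (snd z) +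
      p t (fst z) (snd z) * (q' (snd z) / q t (snd z)) \<partial>?N)"
    using f'_eq int_f by (intro integral_cong_AE) auto
  also have "\<dots> = (\<integral>z. f' z \<partial>?N)"
    using f'(2) p'_base score_base by simp
  finally have f'_h: "(\<integral>z. f' z \<partial>?N) = (\<integral>z. h z \<partial>?N)" ..

  \<comment> \<open>Where \<open>p a = 0\<close> both sides vanish; elsewhere \<open>L_bump\<close>
    applies. Integrability of \<open>g\<close> thus comes from the two finite log
    expectations.\<close>
  have g_eq: "AE z in ?N. p t (fst z) (snd z) * (a (fst z) * ln (r (fst z))) -
      p t (fst z) (snd z) * a (fst z) * ln (post_r (snd z)) = g z"
    using AE_typical_base
  proof eventually_elim
    case (elim z)
    obtain x y where z: "z = (x, y)" by (cases z)
    show ?case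
    proof (cases "p t x y = 0 \<or> a x = 0")
      case False
      then have "L (x, bump i y) - L (x, y) = ln (r x) - ln (post_r y)"
        using elim by (intro L_bump) (auto simp: z)
      then have "p t x y * a x * (L (x, bump i y) - L (x, y)) =
          p t x y * a x * (ln (r x) - ln (post_r y))"
        by simp
      then show ?thesis
        by (simp only: z g_def u_def T_def fst_conv snd_conv) (simp add: algebra_simps)
    qed (auto simp: z g_def u_def)
  qed
  have int_d: "integrable ?N (\<lambda>z. p t (fst z) (snd z) * (a (fst z) * ln (r (fst z))) -
      p t (fst z) (snd z) * a (fst z) * ln (post_r (snd z)))"
    by (intro Bochner_Integration.integrable_diff int_r int_e)
  then have int_g: "integrable ?N g"
    using g_eq by (subst integrable_cong_AE[symmetric]) auto
  have "(\<integral>z. g z \<partial>?N) = (\<integral>z. p t (fst z) (snd z) * (a (fst z) * ln (r (fst z))) -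
      p t (fst z) (snd z) * a (fst z) * ln (post_r (snd z)) \<partial>?N)"
    using g_eq int_d by (intro integral_cong_AE) auto
  also have "\<dots> = (\<integral>z. a (fst z) * ln (r (fst z)) \<partial>?J) - (\<integral>z. ?ea z * ln (?er z) \<partial>?J)"
    using int_r int_e by (simp add: cond_J rate_J)
  finally have g_J: "(\<integral>z. g z \<partial>?N) =
      (\<integral>z. a (fst z) * ln (r (fst z)) \<partial>?J) - (\<integral>z. ?ea z * ln (?er z) \<partial>?J)" .

  have "(\<integral>z. h z \<partial>?N) = (\<integral>z. g z \<partial>?N)"
    unfolding h_def g_def
  proof (rule shift_by_parts[where T = T and \<kappa> = "\<lambda>z. snd z $ i" and r = "\<lambda>z. r (fst z)" and u = u and L = L])
    show "distr ?N ?N T = density ?N (\<lambda>z. ennreal (of_bool (0 < snd z $ i)))"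
      unfolding T_def by (rule distr_bump)
    show "AE z in ?N. 0 \<le> r (fst z)"
      using AE_typical_base by eventually_elim (simp add: typical_def)
    show "AE z in ?N. r (fst z) = 0 \<longrightarrow> u z = 0"
      using AE_typical_base by eventually_elim (simp add: typical_def u_def)
    show "AE z in ?N. u (T z) * (real (snd z $ i) + 1) = r (fst z) * u z"
      using AE_typical_base
    proof eventually_elim
      case (elim z)
      have "u (T z) * (real (snd z $ i) + 1) = (p t (fst z) (bump i (snd z)) * (real (snd z $ i) + 1)) * a (fst z)"
        by (simp add: u_def T_def)
      also have "\<dots> = r (fst z) * u z"
        by (subst p_bump[OF elim]) (simp add: u_def)
      finally show ?case .
    qed
  qed (use int_h int_g in \<open>auto simp: h_def g_def T_def\<close>)
  then have "(\<integral>z. f' z \<partial>?N) = (\<integral>z. a (fst z) * ln (r (fst z)) \<partial>?J) - (\<integral>z. ?ea z * ln (?er z) \<partial>?J)"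
    by (simp add: f'_h g_J)
  with f'(3) show ?thesis
    unfolding mutual_info_eq[symmetric] by simp
qed

end

section \<open>Paths in the scaling matrix and the dark current\<close>

lemma channel_rate_nonneg:
  assumes "\<And>j. 0 \<le> x $ j" "\<And>j. 0 \<le> \<Phi> $ k $ j" "0 \<le> lam $ k"
  shows "0 \<le> channel_rate \<Phi> lam x k"
  unfolding channel_rate_def matrix_vector_mult_def
  using assms by (auto intro!: add_nonneg_nonneg sum_nonneg)

lemma channel_rate_upd_mat:
  "channel_rate (upd_mat \<Phi> i j s) lam x k =
    channel_rate \<Phi> lam x k + (if k = i then (s - \<Phi> $ i $ j) * x $ j else 0)"
proof -
  have "(\<Sum>l\<in>UNIV. (if k = i \<and> l = j then s else \<Phi> $ k $ l) * x $ l) =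
      (\<Sum>l\<in>UNIV. \<Phi> $ k $ l * x $ l + (if l = j then if k = i then (s - \<Phi> $ i $ j) * x $ j else 0 else 0))"
    by (intro sum.cong) (auto simp: algebra_simps)
  also have "\<dots> = (\<Sum>l\<in>UNIV. \<Phi> $ k $ l * x $ l) + (if k = i then (s - \<Phi> $ i $ j) * x $ j else 0)"
    by (simp add: sum.distrib)
  finally show ?thesis
    by (simp add: channel_rate_def matrix_vector_mult_def upd_mat_def)
qed

lemma channel_rate_upd_vec:
  "channel_rate \<Phi> (upd_vec lam i s) x k =
    channel_rate \<Phi> lam x k + (if k = i then s - lam $ i else 0)"
  by (simp add: channel_rate_def upd_vec_def)

lemma upd_mat_self [simp]: "upd_mat \<Phi> i j (\<Phi> $ i $ j) = \<Phi>"
  by (simp add: upd_mat_def vec_eq_iff)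

lemma upd_vec_self [simp]: "upd_vec lam i (lam $ i) = lam"
  by (simp add: upd_vec_def vec_eq_iff)

theorem theorem1:
  fixes D :: "(real^'n) measure" and \<Phi> :: "real^'n^'m" and lam :: "real^'m"
  defines "J \<equiv> channel D \<Phi> lam"
  defines "X \<equiv> (\<lambda>j \<omega>. fst \<omega> $ j)"
  defines "R \<equiv> (\<lambda>i \<omega>. channel_rate \<Phi> lam (fst \<omega>) i)"
  assumes "prob_space D" and "sets D = sets borel"
    and "AE x in D. \<forall>j. 0 \<le> x $ j"
    and "\<And>i j. 0 \<le> \<Phi> $ i $ j" and "\<And>i. 0 \<le> lam $ i"
  shows
    "(\<forall>i j.
        regular_at D (upd_mat \<Phi> i j) (\<lambda>_. lam) (\<Phi> $ i $ j) \<longrightarrow>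
        log_expectation_finite J (X j) (R i) \<longrightarrow>
        log_expectation_finite J (cond_exp_output J (X j)) (cond_exp_output J (R i)) \<longrightarrow>
        ((\<lambda>t. mutual_info D (upd_mat \<Phi> i j t) lam) has_real_derivative
           (\<integral>\<omega>. X j \<omega> * ln (R i \<omega>) \<partial>J) -
           (\<integral>\<omega>. cond_exp_output J (X j) \<omega> * ln (cond_exp_output J (R i) \<omega>) \<partial>J))
          (at (\<Phi> $ i $ j) within {0..})) \<and>
     (\<forall>i.
        regular_at D (\<lambda>_. \<Phi>) (upd_vec lam i) (lam $ i) \<longrightarrow>
        log_expectation_finite J (\<lambda>_. 1) (R i) \<longrightarrow>
        log_expectation_finite J (\<lambda>_. 1) (cond_exp_output J (R i)) \<longrightarrow>
        ((\<lambda>t. mutual_info D \<Phi> (upd_vec lam i t)) has_real_derivative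
           (\<integral>\<omega>. ln (R i \<omega>) \<partial>J) -
           (\<integral>\<omega>. ln (cond_exp_output J (R i) \<omega>) \<partial>J))
          (at (lam $ i) within {0..}))"
proof (intro conjI allI impI)
  interpret channel_input D
    by (intro channel_input.intro channel_input_axioms.intro) fact+
  fix i j
  assume reg: "regular_at D (upd_mat \<Phi> i j) (\<lambda>_. lam) (\<Phi> $ i $ j)"
    and X: "log_expectation_finite J (X j) (R i)"
    and cond: "log_expectation_finite J (cond_exp_output J (X j)) (cond_exp_output J (R i))"
  \<comment> \<open>Varying the entry (i, j) moves only the \<open>i\<close>-th rate, with slope
    x_j.\<close>
  have "channel_path D (upd_mat \<Phi> i j) (\<lambda>_. lam) (\<Phi> $ i $ j) i (\<lambda>x. x $ j)"
  proof
    show "AE x in D. \<forall>k. 0 \<le> channel_rate (upd_mat \<Phi> i j s) lam x k" if "0 \<le> s" for s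
      using assms(6)
    proof eventually_elim
      case (elim x)
      with that assms(7,8) show ?case
        by (intro allI channel_rate_nonneg) (auto simp: upd_mat_def)
    qed
    show "(\<lambda>x. x $ j) \<in> borel_measurable (borel :: (real^'n) measure)"
      by (intro borel_measurable_continuous_onI continuous_intros)
    show "AE x in D. 0 \<le> x $ j"
      using assms(6) by eventually_elim simp
  qed (use assms(7) reg X in \<open>auto simp: channel_rate_upd_mat J_def X_def R_def\<close>)
  then interpret channel_path D "upd_mat \<Phi> i j" "\<lambda>_. lam" "\<Phi> $ i $ j" i "\<lambda>x. x $ j" .
  show "((\<lambda>t. mutual_info D (upd_mat \<Phi> i j t) lam) has_real_derivative
           (\<integral>\<omega>. X j \<omega> * ln (R i \<omega>) \<partial>J) -
           (\<integral>\<omega>. cond_exp_output J (X j) \<omega> * ln (cond_exp_output J (R i) \<omega>) \<partial>J))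
          (at (\<Phi> $ i $ j) within {0..})"
    using has_derivative_mutual_info cond by (simp add: J_def X_def R_def)
next
  interpret channel_input D
    by (intro channel_input.intro channel_input_axioms.intro) fact+
  fix i
  assume reg: "regular_at D (\<lambda>_. \<Phi>) (upd_vec lam i) (lam $ i)"
    and R: "log_expectation_finite J (\<lambda>_. 1) (R i)"
    and cond: "log_expectation_finite J (\<lambda>_. 1) (cond_exp_output J (R i))"
  have "channel_path D (\<lambda>_. \<Phi>) (upd_vec lam i) (lam $ i) i (\<lambda>x. 1)"
  proof
    show "AE x in D. \<forall>k. 0 \<le> channel_rate \<Phi> (upd_vec lam i s) x k" if "0 \<le> s" for s
      using assms(6)
    proof eventually_elim
      case (elim x)
      with that assms(7,8) show ?case
        by (intro allI channel_rate_nonneg) (auto simp: upd_vec_def)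
    qed
  qed (use assms(8) reg R in \<open>auto simp: channel_rate_upd_vec J_def R_def\<close>)
  then interpret channel_path D "\<lambda>_. \<Phi>" "upd_vec lam i" "lam $ i" i "\<lambda>x. 1" .
  \<comment> \<open>The path result involves the conditional expectation of the constant slope 1.
    Bayes' formula makes it \<open>output_prob\<close> divided by itself, which is 1 because the
    output probability is positive almost surely.\<close>
  have one: "AE z in J. cond_exp_output J (\<lambda>\<omega>. 1) z = 1"
  proof -
    have "AE z in J. 0 < output_prob D \<Phi> lam (snd z)"
    proof -
      have "AE z in base_space. 0 < ennreal (channel_prob \<Phi> lam (fst z) (snd z)) \<longrightarrow>
          0 < output_prob D \<Phi> lam (snd z)"
        using AE_typical_base
      proof eventually_elim
        case (elim z)
        then show ?case using q_pos[of "fst z" "snd z"] by auto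
      qed
      then show ?thesis unfolding J_def channel_eq by (subst AE_density) auto
    qed
    moreover have "AE z in J. cond_exp_output J (\<lambda>\<omega>. 1) z =
        (\<integral>x. channel_prob \<Phi> lam x (snd z) * 1 \<partial>D) / output_prob D \<Phi> lam (snd z)"
      unfolding J_def by (rule cond_exp_output_eq) (auto simp: integrable_channel_prob)
    ultimately show ?thesis
      by eventually_elim (simp add: output_prob_def)
  qed
  have m: "cond_exp_output J f \<in> borel_measurable J" for f
    unfolding cond_exp_output_def by measurable
  have eq: "AE z in J. ln (cond_exp_output J (R i) z) =
      cond_exp_output J (\<lambda>\<omega>. 1) z * ln (cond_exp_output J (R i) z)"
    using one by eventually_elim simp
  have "log_expectation_finite J (cond_exp_output J (\<lambda>\<omega>. 1)) (cond_exp_output J (R i))"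
    unfolding log_expectation_finite_def
  proof
    \<comment> \<open>With weight 1, the hypothesis says that the conditional rate is almost surely
      nonzero, so the implication is vacuous.\<close>
    show "AE z in J. cond_exp_output J (R i) z = 0 \<longrightarrow> cond_exp_output J (\<lambda>\<omega>. 1) z = 0"
      using cond by (auto simp: log_expectation_finite_def)
    show "integrable J (\<lambda>z. cond_exp_output J (\<lambda>\<omega>. 1) z * ln (cond_exp_output J (R i) z))"
      by (rule integrable_cong_AE_imp[OF _ _ eq])
         (use cond m in \<open>auto simp: log_expectation_finite_def\<close>)
  qed
  moreover have "(\<integral>\<omega>. ln (cond_exp_output J (R i) \<omega>) \<partial>J) =
      (\<integral>\<omega>. cond_exp_output J (\<lambda>\<omega>. 1) \<omega> * ln (cond_exp_output J (R i) \<omega>) \<partial>J)"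
    using eq m by (intro integral_cong_AE) auto
  ultimately show "((\<lambda>t. mutual_info D \<Phi> (upd_vec lam i t)) has_real_derivative
           (\<integral>\<omega>. ln (R i \<omega>) \<partial>J) -
           (\<integral>\<omega>. ln (cond_exp_output J (R i) \<omega>) \<partial>J))
          (at (lam $ i) within {0..})"
    using has_derivative_mutual_info by (simp add: J_def R_def)
qed

end
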